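(* Let $\mathcal{E} = (\omega,E)$ be an equivalence structure. Then the following are equivalent: (a) $\mathcal{E}$ has a faithfully strongly generically computable copy; (b) $\mathcal{E}$ has a faithfully generically computable copy; (c) $\mathcal{E}$ has a faithfully generically computably enumerable copy; (d) $\mathcal{E}$ has an infinite faithful substructure with a computable copy; (e) $\mathcal{E}$ has an infinite faithful substructure with a computably enumerable copy; (f) either (i) $\mathcal{E}$ has an infinite equivalence class, or (ii) there is a finite $k$ such that $\mathcal{E}$ has infinitely many equivalence classes of size $k$, or (iii) $\chi(\mathcal{E})$ has an infinite $\Sigma^0_2$ subset which possesses a computable $s_1$-function.
   Context: An equivalence structure $(A,R)$ is a set $A$ with an equivalence relation $R$ on $A$. A copy of an equivalence structure $(A,R)$ with $A$ infinite is an isomorphic equivalence structure $(\omega,R')$; the copy is computable (computably enumerable) if $R'$ is computable (computably enumerable). The copy is said to have one of the properties below if $R'$ has it. A set $S\subseteq\omega$ has asymptotic density $\delta$ if $\lim_{n\to\infty} |S\cap\{0,\dots,n\}|/(n+1)=\delta$. For an equivalence relation $R$, a set $A$ is $R$-faithful if whenever $a\in A$ and $R(a,b)$ or $R(b,a)$, then $b\in A$; i.e. $A$ is a union of $R$-classes. A faithful substructure of $(\omega,E)$ is $(A, E\cap (A\times A))$ with $A$ being $E$-faithful. An equivalence relation $R$ on $\omega$ is generically computable if there are a partial computable function $\Phi:\omega^2\to\{0,1\}$ with $\Phi=\chi_R$ (the characteristic function of $R$) on the domain of $\Phi$, and a computably enumerable set $A$ of asymptotic density 1 with $A\times A\subseteq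 \mathrm{Dom}(\Phi)$; it is faithfully generically computable if such $\Phi, A$ exist with $A$ being $R$-faithful. $R$ is strongly generically computable if there are a computable equivalence relation $S$ on $\omega$ and a computably enumerable set $A$ of asymptotic density 1 such that $R$ agrees with $S$ on $A\times A$; faithfully strongly generically computable if moreover $A$ can be taken both $R$-faithful and $S$-faithful. $R$ is generically computably enumerable if there are a computably enumerable equivalence relation $S$ on a computably enumerable set $B$ and a computably enumerable set $A\subseteq B$ of asymptotic density 1 such that $R$ agrees with $S$ on $A\times A$; faithfully generically computably enumerable if moreover $A$ can be taken both $R$-faithful and $S$-faithful. The character of an equivalence structure $\mathcal{A}$ is $\chi(\mathcal{A})=\{(k,n): \mathcal{A}\text{ has at least } n \text{ equivalence classes of size } k\}$, where $k,n$ range over positive integers. A function $f:\omega^2\to\omega$ is an $s_1$-function if (1) $f(i,s)\le f(i,s+1)$ for all $i,s$; (2) for every $i$ the limit $m_i=\lim_{s\to\infty} f(i,s)$ exists (is finite); (3) $m_i<m_{i+1}$ for every $i$. A set $K$ of pairs possesses the $s_1$-function $f$ if it has a class of size $m_i$ for each $i$, i.e. $(m_i,1)\in K$ for each $i$. *)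

theory Defs
  imports Complex_Main "HOL-Library.Nat_Bijection"
begin

text \<open>Computability is given by Kleene's partial recursive functions. Terms carry no arity:
  \<open>Zero\<close> and \<open>Proj i\<close> act as the constant and the \<open>i\<close>-th projection (counted from 0) for every
  number of arguments. \<open>PrimRec\<close> recurses on, and \<open>Mu\<close> searches over, the first argument.
  \<open>None\<close> means divergence, or arguments on which the term is ill-formed.\<close>

datatype recf =
    Zero
  | Succ
  | Proj nat
  | Comp recf "recf list"
  | PrimRec recf recf
  | Mu recf

fun eval :: "recf \<Rightarrow> nat list \<Rightarrow> nat option" where
  "eval Zero xs = Some 0"
| "eval Succ xs = (case xs of [x] \<Rightarrow> Some (Suc x) | _ \<Rightarrow> None)"
| "eval (Proj i) xs = (if i < length xs then Some (xs ! i) else None)"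
| "eval (Comp f gs) xs = Option.bind (those (map (\<lambda>g. eval g xs) gs)) (\<lambda>ys. eval f ys)"
| "eval (PrimRec f g) xs =
    (case xs of
       [] \<Rightarrow> None
     | n # ys \<Rightarrow> rec_nat (eval f ys) (\<lambda>m r. Option.bind r (\<lambda>z. eval g (m # z # ys))) n)"
| "eval (Mu f) xs =
    (if \<exists>n. eval f (n # xs) = Some 0 \<and> (\<forall>m<n. eval f (m # xs) \<noteq> None)
     then Some (LEAST n. eval f (n # xs) = Some 0) else None)"

definition partial_computable :: "nat \<Rightarrow> (nat list \<Rightarrow> nat option) \<Rightarrow> bool" where
  "partial_computable k \<phi> \<longleftrightarrow> (\<exists>p. \<forall>xs. length xs = k \<longrightarrow> eval p xs = \<phi> xs)"

definition computable :: "nat \<Rightarrow> (nat list \<Rightarrow> nat) \<Rightarrow> bool" where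
  "computable k f \<longleftrightarrow> partial_computable k (\<lambda>xs. Some (f xs))"

definition computable_rel :: "nat rel \<Rightarrow> bool" where
  "computable_rel R \<longleftrightarrow> computable 2 (\<lambda>xs. of_bool ((xs ! 0, xs ! 1) \<in> R))"

definition ce_set :: "nat set \<Rightarrow> bool" where
  "ce_set A \<longleftrightarrow> A = {} \<or> (\<exists>f. computable 1 (\<lambda>xs. f (xs ! 0)) \<and> A = range f)"

definition ce_rel :: "nat rel \<Rightarrow> bool" where
  "ce_rel R \<longleftrightarrow> ce_set (prod_encode ` R)"

definition Sigma02_rel :: "nat rel \<Rightarrow> bool" where
  "Sigma02_rel K \<longleftrightarrow>
    (\<exists>Q. computable 4 (\<lambda>xs. of_bool (Q (xs ! 0) (xs ! 1) (xs ! 2) (xs ! 3))) \<and>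
         (\<forall>x y. (x, y) \<in> K \<longleftrightarrow> (\<exists>u. \<forall>v. Q x y u v)))"

definition has_density :: "nat set \<Rightarrow> real \<Rightarrow> bool" where
  "has_density S \<delta> \<longleftrightarrow> (\<lambda>n. real (card (S \<inter> {0..n})) / real (n + 1)) \<longlonglongrightarrow> \<delta>"

definition faithful :: "'a rel \<Rightarrow> 'a set \<Rightarrow> bool" where
  "faithful R A \<longleftrightarrow> (\<forall>a b. a \<in> A \<and> ((a, b) \<in> R \<or> (b, a) \<in> R) \<longrightarrow> b \<in> A)"

definition agree_on :: "'a set \<Rightarrow> 'a rel \<Rightarrow> 'a rel \<Rightarrow> bool" where
  "agree_on A R S \<longleftrightarrow> R \<inter> A \<times> A = S \<inter> A \<times> A"

definition is_copy :: "'a set \<Rightarrow> 'a rel \<Rightarrow> nat rel \<Rightarrow> bool" where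
  "is_copy A R R' \<longleftrightarrow> equiv UNIV R' \<and>
    (\<exists>h. bij_betw h A UNIV \<and> (\<forall>x\<in>A. \<forall>y\<in>A. (x, y) \<in> R \<longleftrightarrow> (h x, h y) \<in> R'))"

definition faithfully_generically_computable :: "nat rel \<Rightarrow> bool" where
  "faithfully_generically_computable R \<longleftrightarrow>
    (\<exists>\<Phi> A. partial_computable 2 (\<lambda>xs. \<Phi> (xs ! 0) (xs ! 1)) \<and>
       (\<forall>x y v. \<Phi> x y = Some v \<longrightarrow> v = of_bool ((x, y) \<in> R)) \<and>
       ce_set A \<and> has_density A 1 \<and> (\<forall>x\<in>A. \<forall>y\<in>A. \<Phi> x y \<noteq> None) \<and>
       faithful R A)"

definition faithfully_strongly_generically_computable :: "nat rel \<Rightarrow> bool" where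
  "faithfully_strongly_generically_computable R \<longleftrightarrow>
    (\<exists>S A. equiv UNIV S \<and> computable_rel S \<and> ce_set A \<and> has_density A 1 \<and>
       agree_on A R S \<and> faithful R A \<and> faithful S A)"

definition faithfully_generically_ce :: "nat rel \<Rightarrow> bool" where
  "faithfully_generically_ce R \<longleftrightarrow>
    (\<exists>S B A. ce_set B \<and> equiv B S \<and> ce_rel S \<and> ce_set A \<and> A \<subseteq> B \<and> has_density A 1 \<and>
       agree_on A R S \<and> faithful R A \<and> faithful S A)"

definition has_copy_with :: "(nat rel \<Rightarrow> bool) \<Rightarrow> 'a set \<Rightarrow> 'a rel \<Rightarrow> bool" where
  "has_copy_with P A R \<longleftrightarrow> (\<exists>R'. is_copy A R R' \<and> P R')"

definition has_inf_faithful_substructure_with :: "(nat rel \<Rightarrow> bool) \<Rightarrow> nat rel \<Rightarrow> bool" where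
  "has_inf_faithful_substructure_with P E \<longleftrightarrow>
    (\<exists>A. infinite A \<and> faithful E A \<and> has_copy_with P A (E \<inter> A \<times> A))"

text \<open>Finiteness is explicit because \<open>card\<close> of an infinite class is 0.\<close>

definition classes_of_size :: "'a set \<Rightarrow> 'a rel \<Rightarrow> nat \<Rightarrow> 'a set set" where
  "classes_of_size A R k = {C \<in> A // R. finite C \<and> card C = k}"

definition eq_character :: "'a set \<Rightarrow> 'a rel \<Rightarrow> nat rel" where
  "eq_character A R =
    {(k, n). 0 < k \<and> 0 < n \<and> (\<exists>T \<subseteq> classes_of_size A R k. finite T \<and> card T = n)}"

text \<open>On \<open>nat\<close>, with its discrete topology, a sequence converges iff it is eventually constant.\<close>

definition s1_function :: "(nat \<Rightarrow> nat \<Rightarrow> nat) \<Rightarrow> bool" where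
  "s1_function f \<longleftrightarrow>
    (\<forall>i s. f i s \<le> f i (Suc s)) \<and>
    (\<forall>i. convergent (f i)) \<and>
    (\<forall>i. lim (f i) < lim (f (Suc i)))"

definition possesses_s1 :: "nat rel \<Rightarrow> (nat \<Rightarrow> nat \<Rightarrow> nat) \<Rightarrow> bool" where
  "possesses_s1 K f \<longleftrightarrow> s1_function f \<and> (\<forall>i. (lim (f i), 1) \<in> K)"

definition computable_s1_condition :: "nat rel \<Rightarrow> bool" where
  "computable_s1_condition X \<longleftrightarrow>
    (\<exists>K \<subseteq> X. infinite K \<and> Sigma02_rel K \<and>
       (\<exists>f. computable 2 (\<lambda>xs. f (xs ! 0) (xs ! 1)) \<and> possesses_s1 K f))"

end

theory Submission
  imports Defs "HOL-Library.Infinite_Set"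
begin

text \<open>The conditions are linked in the cycle (a) to (b) to (c) to (e) to (f) to (d) to (a).

Density is a weak constraint on a copy, because a copy may place the elements anywhere. A set of
density 1 is infinite, so a generic copy always contains an infinite faithful c.e. part, which
becomes a c.e. structure on all of \<open>\<nat>\<close> once that part is enumerated injectively
(\<open>ce_substructure_if_generically_ce_copy\<close>). Conversely an infinite faithful computable part
can be spread over a decidable set \<open>D\<close> of density 1 whose complement has as many elements as
remain outside that part; declaring the whole complement of \<open>D\<close> to be a single class gives the
computable relation that the strongly generic copy agrees with on \<open>D\<close>
(\<open>strongly_generic_copy_if_computable_substructure\<close>).

The remaining gap between c.e. and computable structures is bridged by class sizes. In a c.e.
structure, the number of elements seen to be equivalent to \<open>x\<close> by stage \<open>s\<close> approximates the
size of the class of \<open>x\<close> from below. If all classes are finite and each size occurs finitely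
often, the sizes in an infinite faithful part are unbounded, and every computable approximation from
below to an unbounded family of sizes yields a computable \<open>s\<^sub>1\<close>-function with limits among
these sizes (\<open>s1_function_from_approximation\<close>). The set of limits of a computable
\<open>s\<^sub>1\<close>-function \<open>f\<close> is \<open>\<Sigma>\<^sup>0\<^sub>2\<close>, since \<open>x\<close> is a limit iff \<open>f i (t + v) = x\<close> for
some \<open>i\<close> and \<open>t\<close> and all \<open>v\<close>.

In the other direction, take one class of size \<open>m\<^sub>i = lim\<^sub>s f(i,s)\<close> for each \<open>i\<close>; the
sizes differ, so these are different classes. Their union is isomorphic to the set of tokens
\<open>(i, j, s)\<close> in which \<open>s\<close> is the first stage with \<open>j < f(i,s)\<close>, two tokens being equivalent
iff their first components agree. Recording the stage \<open>s\<close> makes the set of tokens decidable,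
although \<open>m\<^sub>i\<close> itself is known only in the limit. An infinite class, or infinitely many
classes of one finite size, are handled by simpler sets of tokens
(\<open>computable_substructure_if_tokens\<close>).\<close>

section \<open>Closure properties of computable functions on lists\<close>

lemma computableI:
  assumes "\<And>xs. length xs = k \<Longrightarrow> eval p xs = Some (f xs)"
  shows "computable k f"
  using assms unfolding computable_def partial_computable_def by blast

lemma computableE:
  assumes "computable k f"
  obtains p where "\<forall>xs. length xs = k \<longrightarrow> eval p xs = Some (f xs)"
  using assms unfolding computable_def partial_computable_def by blast

lemma computable_cong:
  assumes "computable k f" "\<And>xs. length xs = k \<Longrightarrow> f xs = g xs"
  shows "computable k g"
  using assms unfolding computable_def partial_computable_def by auto

lemma computable_nth: "i < k \<Longrightarrow> computable k (\<lambda>xs. xs ! i)"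
  by (rule computableI[where p = "Proj i"]) simp

lemma computable_zero: "computable k (\<lambda>xs. 0)"
  by (rule computableI[where p = Zero]) simp

lemma those_map_Some:
  "\<forall>x\<in>set xs. f x = Some (g x) \<Longrightarrow> those (map f xs) = Some (map g xs)"
  by (induction xs) auto

lemma computable_compose:
  assumes "computable (length gs) f" "\<And>g. g \<in> set gs \<Longrightarrow> computable k g"
  shows "computable k (\<lambda>xs. f (map (\<lambda>g. g xs) gs))"
proof -
  obtain p where p: "\<forall>xs. length xs = length gs \<longrightarrow> eval p xs = Some (f xs)"
    using assms(1) by (elim computableE)
  have "\<forall>g\<in>set gs. \<exists>q. \<forall>xs. length xs = k \<longrightarrow> eval q xs = Some (g xs)"
    using assms(2) unfolding computable_def partial_computable_def by simp
  then obtain q where q: "\<forall>g\<in>set gs. \<forall>xs. length xs = k \<longrightarrow> eval (q g) xs = Some (g xs)"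
    by (rule bchoice[THEN exE])
  have "those (map (\<lambda>h. eval h xs) (map q gs)) = Some (map (\<lambda>g. g xs) gs)" if "length xs = k" for xs
    unfolding map_map by (rule those_map_Some) (use q that in simp)
  then have "eval (Comp p (map q gs)) xs = Some (f (map (\<lambda>g. g xs) gs))" if "length xs = k" for xs
    using p that by (simp del: map_map)
  then show ?thesis by (rule computableI)
qed

section \<open>A calculus of unary recursive functions\<close>

text \<open>Through the pairing function every number of arguments reduces to one. Closure rules for unary
functions then involve neither argument lists nor their lengths, and recursiveness of an explicitly
given function follows by resolution along its syntax with the rules \<open>recursive_intros\<close>. The
variant with two arguments serves to build the arithmetic functions from which pairing is composed.\<close>

definition recursive :: "(nat \<Rightarrow> nat) \<Rightarrow> bool" where
  "recursive f \<longleftrightarrow> computable 1 (\<lambda>xs. f (xs ! 0))"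

definition recursive2 :: "(nat \<Rightarrow> nat \<Rightarrow> nat) \<Rightarrow> bool" where
  "recursive2 F \<longleftrightarrow> computable 2 (\<lambda>xs. F (xs ! 0) (xs ! 1))"

lemma computable_app:
  assumes "recursive f" "computable k g"
  shows "computable k (\<lambda>xs. f (g xs))"
  using computable_compose[of "[g]" "\<lambda>xs. f (xs ! 0)" k] assms unfolding recursive_def by simp

lemma computable_app2:
  assumes "recursive2 F" "computable k f" "computable k g"
  shows "computable k (\<lambda>xs. F (f xs) (g xs))"
  using computable_compose[of "[f, g]" "\<lambda>xs. F (xs ! 0) (xs ! 1)" k] assms
  unfolding recursive2_def by (auto simp: numeral_2_eq_2)

lemma recursive_app: "recursive f \<Longrightarrow> recursive g \<Longrightarrow> recursive (\<lambda>x. f (g x))"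
  using computable_app[of f 1 "\<lambda>xs. g (xs ! 0)"] by (simp add: recursive_def)

lemma recursive_app2:
  "recursive2 F \<Longrightarrow> recursive f \<Longrightarrow> recursive g \<Longrightarrow> recursive (\<lambda>x. F (f x) (g x))"
  using computable_app2[of F 1 "\<lambda>xs. f (xs ! 0)" "\<lambda>xs. g (xs ! 0)"] by (simp add: recursive_def)

lemma computable_rec_nat:
  assumes "computable k f" "computable (Suc (Suc k)) g"
  shows "computable (Suc k) (\<lambda>xs. rec_nat (f (tl xs)) (\<lambda>m z. g (m # z # tl xs)) (hd xs))"
proof -
  obtain p where p: "\<forall>xs. length xs = k \<longrightarrow> eval p xs = Some (f xs)"
    using assms(1) by (elim computableE)
  obtain q where q: "\<forall>xs. length xs = Suc (Suc k) \<longrightarrow> eval q xs = Some (g xs)"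
    using assms(2) by (elim computableE)
  have "rec_nat (eval p ys) (\<lambda>m r. Option.bind r (\<lambda>z. eval q (m # z # ys))) n
      = Some (rec_nat (f ys) (\<lambda>m z. g (m # z # ys)) n)" if "length ys = k" for n ys
    by (induction n) (simp_all add: p q that)
  then have "eval (PrimRec p q) xs = Some (rec_nat (f (tl xs)) (\<lambda>m z. g (m # z # tl xs)) (hd xs))"
    if "length xs = Suc k" for xs
    using that by (cases xs) auto
  then show ?thesis by (rule computableI)
qed

lemma computable_Least:
  assumes "computable (Suc k) f" "\<And>xs. length xs = k \<Longrightarrow> \<exists>n. f (n # xs) = 0"
  shows "computable k (\<lambda>xs. LEAST n. f (n # xs) = 0)"
proof -
  obtain p where p: "\<forall>xs. length xs = Suc k \<longrightarrow> eval p xs = Some (f xs)"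
    using assms(1) by (elim computableE)
  have "eval (Mu p) xs = Some (LEAST n. f (n # xs) = 0)" if "length xs = k" for xs
    using assms(2)[OF that] that by (simp add: p)
  then show ?thesis by (rule computableI)
qed

lemma recursive2_rec_nat:
  assumes "recursive a" "computable 3 (\<lambda>xs. g (xs ! 0) (xs ! 1) (xs ! 2))"
  shows "recursive2 (\<lambda>n x. rec_nat (a x) (\<lambda>m z. g m z x) n)"
proof -
  have "computable (Suc 1) (\<lambda>xs. rec_nat (a (tl xs ! 0))
      (\<lambda>m z. g ((m # z # tl xs) ! 0) ((m # z # tl xs) ! 1) ((m # z # tl xs) ! 2)) (hd xs))"
    by (rule computable_rec_nat)
      (use assms in \<open>simp_all add: recursive_def numeral_3_eq_3 del: nth_Cons_numeral\<close>)
  then show ?thesis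
    unfolding recursive2_def
    unfolding Suc_1
    by (rule computable_cong) (auto simp: length_Suc_conv numeral_2_eq_2)
qed

lemma recursive_cong:
  assumes "recursive f" "\<And>x. f x = g x"
  shows "recursive g"
proof -
  have "f = g" by (rule ext) (rule assms(2))
  then show ?thesis using assms(1) by simp
qed

lemma recursive2_cong:
  assumes "recursive2 F" "\<And>x y. F x y = G x y"
  shows "recursive2 G"
proof -
  have "F = G" by (intro ext) (rule assms(2))
  then show ?thesis using assms(1) by simp
qed

lemma recursive_rec_nat_without_parameter:
  assumes "recursive2 g" "recursive n"
  shows "recursive (\<lambda>x. rec_nat 0 g (n x))"
proof -
  have "recursive (\<lambda>x. 0)"
    unfolding recursive_def by (rule computable_zero)
  moreover have "computable 3 (\<lambda>xs. g (xs ! 0) (xs ! 1))"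
    by (intro computable_app2[OF assms(1)] computable_nth) auto
  ultimately have "recursive2 (\<lambda>n x. rec_nat 0 (\<lambda>m z. g m z) n)"
    by (rule recursive2_rec_nat)
  from recursive_app2[OF this assms(2) assms(2)] show ?thesis .
qed

named_theorems recursive_intros

lemma recursive_ident [recursive_intros]: "recursive (\<lambda>x. x)"
  unfolding recursive_def by (rule computable_nth) simp

lemma recursive2_fst: "recursive2 (\<lambda>x y. x)"
  unfolding recursive2_def by (rule computable_nth) simp

lemma recursive_successor: "recursive Suc"
  unfolding recursive_def
  by (rule computableI[where p = Succ]) (auto simp: length_Suc_conv)

lemma recursive_Suc [recursive_intros]: "recursive f \<Longrightarrow> recursive (\<lambda>x. Suc (f x))"
  by (rule recursive_app[OF recursive_successor])

lemma recursive_const [recursive_intros]: "recursive (\<lambda>x. c)"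
proof (induction c)
  case 0
  show ?case unfolding recursive_def by (rule computable_zero)
next
  case (Suc c)
  then show ?case by (rule recursive_Suc)
qed

lemma recursive2_add: "recursive2 (+)"
proof -
  have "recursive2 (\<lambda>n x. rec_nat x (\<lambda>m z. Suc z) n)"
    by (intro recursive2_rec_nat recursive_ident computable_app[OF recursive_successor] computable_nth) simp
  moreover have "rec_nat x (\<lambda>m z. Suc z) n = n + x" for n x :: nat
    by (induction n) auto
  ultimately show ?thesis by (rule recursive2_cong)
qed

lemma recursive_pred: "recursive (\<lambda>x. x - 1)"
proof -
  have "recursive (\<lambda>n. rec_nat 0 (\<lambda>m z. m) n)"
    by (intro recursive_rec_nat_without_parameter recursive2_fst recursive_ident)
  moreover have "rec_nat 0 (\<lambda>m z. m) n = n - 1" for n :: nat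
    by (cases n) auto
  ultimately show ?thesis by (rule recursive_cong)
qed

lemma recursive2_diff: "recursive2 (-)"
proof -
  have "recursive2 (\<lambda>n x. rec_nat x (\<lambda>m z. z - 1) n)"
    by (intro recursive2_rec_nat recursive_ident computable_app[OF recursive_pred] computable_nth) simp
  moreover have "rec_nat x (\<lambda>m z. z - 1) n = x - n" for n x :: nat
    by (induction n) auto
  ultimately have "recursive2 (\<lambda>n x. x - n)" by (rule recursive2_cong)
  then have "computable 2 (\<lambda>xs. xs ! 0 - xs ! 1)"
    using computable_app2[of "\<lambda>n x. x - n" 2 "\<lambda>xs. xs ! 1" "\<lambda>xs. xs ! 0"]
    by (simp add: computable_nth)
  then show ?thesis by (simp add: recursive2_def)
qed

lemma recursive2_mult: "recursive2 (*)"
proof -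
  have "recursive2 (\<lambda>n x. rec_nat 0 (\<lambda>m z. z + x) n)"
    by (intro recursive2_rec_nat recursive_const computable_app2[OF recursive2_add] computable_nth) auto
  moreover have "rec_nat 0 (\<lambda>m z. z + x) n = n * x" for n x :: nat
    by (induction n) auto
  ultimately show ?thesis by (rule recursive2_cong)
qed

lemmas recursive_add [recursive_intros] = recursive_app2[OF recursive2_add]
lemmas recursive_diff [recursive_intros] = recursive_app2[OF recursive2_diff]
lemmas recursive_mult [recursive_intros] = recursive_app2[OF recursive2_mult]

lemma recursive_triangle: "recursive triangle"
proof -
  have "recursive2 (\<lambda>m z. z + Suc m)"
    unfolding recursive2_def
    by (intro computable_app2[OF recursive2_add] computable_app[OF recursive_successor] computable_nth) auto
  then have "recursive (\<lambda>n. rec_nat 0 (\<lambda>m z. z + Suc m) n)"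
    by (rule recursive_rec_nat_without_parameter) (rule recursive_ident)
  moreover have "rec_nat 0 (\<lambda>m z. z + Suc m) n = triangle n" for n
    by (induction n) auto
  ultimately show ?thesis by (rule recursive_cong)
qed

lemma recursive2_prod_encode: "recursive2 (\<lambda>x y. prod_encode (x, y))"
proof -
  have "computable 2 (\<lambda>xs. triangle (xs ! 0 + xs ! 1) + xs ! 0)"
    by (intro computable_app2[OF recursive2_add] computable_app[OF recursive_triangle] computable_nth) auto
  then show ?thesis by (simp add: recursive2_def prod_encode_def)
qed

lemmas recursive_prod_encode [recursive_intros] = recursive_app2[OF recursive2_prod_encode]

lemma triangle_le_mono: "m \<le> n \<Longrightarrow> triangle m \<le> triangle n"
  by (rule lift_Suc_mono_le) auto

text \<open>The index of the diagonal of the pairing function that contains \<open>z\<close>, that is, the sum of the two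
components of \<open>prod_decode z\<close>. The search for it is written with truncated subtraction so that it
is an instance of the minimisation operator.\<close>

definition diagonal :: "nat \<Rightarrow> nat" where
  "diagonal z = (LEAST w. Suc z - triangle (Suc w) = 0)"

lemma diagonal_triangle: "m \<le> w \<Longrightarrow> diagonal (triangle w + m) = w"
  unfolding diagonal_def
proof (rule Least_equality)
  fix v assume *: "m \<le> w" "Suc (triangle w + m) - triangle (Suc v) = 0"
  show "w \<le> v"
  proof (rule ccontr)
    assume "\<not> w \<le> v"
    then have "triangle (Suc v) \<le> triangle w"
      by (intro triangle_le_mono) simp
    then show False using * by linarith
  qed
qed simp

lemma prod_decode_diagonal:
  "prod_decode z = (z - triangle (diagonal z), diagonal z - (z - triangle (diagonal z)))"
proof -
  obtain m n where z: "z = prod_encode (m, n)"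
    using surj_prod_encode by (metis prod_decode_inverse surj_pair)
  then have "diagonal z = m + n"
    by (simp add: prod_encode_def diagonal_triangle)
  then show ?thesis
    using z by (simp add: prod_encode_def[symmetric]) (simp add: prod_encode_def)
qed

lemma recursive_diagonal: "recursive diagonal"
proof -
  have "computable (Suc 1) (\<lambda>xs. Suc (xs ! 1) - triangle (Suc (xs ! 0)))"
    by (intro computable_app2[OF recursive2_diff] computable_app[OF recursive_successor]
        computable_app[OF recursive_triangle] computable_nth) auto
  moreover have "\<exists>n. Suc z - triangle (Suc n) = 0" for z
  proof -
    have "n \<le> triangle n" for n by (induction n) auto
    from this[of "Suc z"] show ?thesis by (intro exI[of _ z]) auto
  qed
  ultimately have "computable 1 (\<lambda>xs. LEAST n. Suc ((n # xs) ! 1) - triangle (Suc ((n # xs) ! 0)) = 0)"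
    by (intro computable_Least) auto
  then show ?thesis
    by (simp add: recursive_def diagonal_def)
qed

abbreviation \<pi>1 :: "nat \<Rightarrow> nat" where "\<pi>1 z \<equiv> fst (prod_decode z)"
abbreviation \<pi>2 :: "nat \<Rightarrow> nat" where "\<pi>2 z \<equiv> snd (prod_decode z)"

lemma recursive_fst [recursive_intros]:
  assumes "recursive f" shows "recursive (\<lambda>x. \<pi>1 (f x))"
  unfolding prod_decode_diagonal[of "f _"] fst_conv
  by (intro recursive_diff assms recursive_app[OF recursive_triangle] recursive_app[OF recursive_diagonal])

lemma recursive_snd [recursive_intros]:
  assumes "recursive f" shows "recursive (\<lambda>x. \<pi>2 (f x))"
  unfolding prod_decode_diagonal[of "f _"] snd_conv
  by (intro recursive_diff assms recursive_app[OF recursive_triangle] recursive_app[OF recursive_diagonal])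

lemma recursive2_iff: "recursive2 F \<longleftrightarrow> recursive (\<lambda>z. F (\<pi>1 z) (\<pi>2 z))"
proof
  assume "recursive2 F"
  then show "recursive (\<lambda>z. F (\<pi>1 z) (\<pi>2 z))"
    by (rule recursive_app2) (intro recursive_intros)+
next
  assume *: "recursive (\<lambda>z. F (\<pi>1 z) (\<pi>2 z))"
  have "computable 2 (\<lambda>xs. prod_encode (xs ! 0, xs ! 1))"
    using recursive2_prod_encode unfolding recursive2_def .
  from computable_app[OF * this] show "recursive2 F" by (simp add: recursive2_def)
qed

text \<open>Closure under substitution for a function of two arguments, in a form that resolution can apply when
\<open>F\<close> is a constant or a local variable.\<close>

lemma recursive_subst:
  assumes "recursive (\<lambda>z. F (\<pi>1 z) (\<pi>2 z))" "recursive f" "recursive g"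
  shows "recursive (\<lambda>x. F (f x) (g x))"
  using recursive_app2[OF assms(1)[folded recursive2_iff] assms(2,3)] .

lemma computable_3I:
  assumes "recursive (\<lambda>p. F (\<pi>1 p) (\<pi>1 (\<pi>2 p))
                           (\<pi>2 (\<pi>2 p)))"
  shows "computable 3 (\<lambda>xs. F (xs ! 0) (xs ! 1) (xs ! 2))"
proof -
  have "computable 3 (\<lambda>xs. prod_encode (xs ! 0, prod_encode (xs ! 1, xs ! 2)))"
    by (intro computable_app2[OF recursive2_prod_encode] computable_nth) auto
  from computable_app[OF assms this] show ?thesis by simp
qed

lemma computable_4I:
  assumes "recursive (\<lambda>p. F (\<pi>1 p) (\<pi>1 (\<pi>2 p))
                           (\<pi>1 (\<pi>2 (\<pi>2 p)))
                           (\<pi>2 (\<pi>2 (\<pi>2 p))))"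
  shows "computable 4 (\<lambda>xs. F (xs ! 0) (xs ! 1) (xs ! 2) (xs ! 3))"
proof -
  have "computable 4 (\<lambda>xs. prod_encode (xs ! 0, prod_encode (xs ! 1, prod_encode (xs ! 2, xs ! 3))))"
    by (intro computable_app2[OF recursive2_prod_encode] computable_nth) auto
  from computable_app[OF assms this] show ?thesis by simp
qed

text \<open>The step \<open>g\<close> may depend on the argument \<open>x\<close>. Its recursiveness is expressed on codes of triples
because the rule must again produce a goal about a unary function; the same device recurs in the rules
for the other variable binders below.\<close>

lemma recursive_rec_nat [recursive_intros]:
  assumes "recursive a" "recursive n"
    "recursive (\<lambda>p. g (\<pi>1 p) (\<pi>1 (\<pi>2 p))
                      (\<pi>2 (\<pi>2 p)))"
  shows "recursive (\<lambda>x. rec_nat (a x) (\<lambda>m z. g m z x) (n x))"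
  using recursive_app2[OF recursive2_rec_nat[OF assms(1) computable_3I[OF assms(3)]] assms(2)
      recursive_ident] .

definition decidable :: "(nat \<Rightarrow> bool) \<Rightarrow> bool" where
  "decidable P \<longleftrightarrow> recursive (\<lambda>x. of_bool (P x))"

lemma recursive_of_bool [recursive_intros]: "decidable P \<Longrightarrow> recursive (\<lambda>x. of_bool (P x))"
  by (simp add: decidable_def)

lemma decidable_zero: "recursive f \<Longrightarrow> decidable (\<lambda>x. f x = 0)"
proof -
  assume "recursive f"
  then have "recursive (\<lambda>x. 1 - f x)" by (intro recursive_intros)
  moreover have "1 - f x = of_bool (f x = 0)" for x by auto
  ultimately show ?thesis by (simp add: decidable_def)
qed

lemma decidable_le [recursive_intros]:
  assumes "recursive f" "recursive g" shows "decidable (\<lambda>x. f x \<le> g x)"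
proof -
  have "decidable (\<lambda>x. f x - g x = 0)"
    by (intro decidable_zero recursive_diff assms)
  then show ?thesis by simp
qed

lemma decidable_not [recursive_intros]: "decidable P \<Longrightarrow> decidable (\<lambda>x. \<not> P x)"
proof -
  assume "decidable P"
  then have "decidable (\<lambda>x. (of_bool (P x) :: nat) = 0)"
    unfolding decidable_def[of P] by (rule decidable_zero)
  then show ?thesis by simp
qed

lemma decidable_conj [recursive_intros]:
  assumes "decidable P" "decidable Q" shows "decidable (\<lambda>x. P x \<and> Q x)"
  unfolding decidable_def of_bool_conj by (intro recursive_intros assms)

lemma decidable_disj [recursive_intros]:
  assumes "decidable P" "decidable Q" shows "decidable (\<lambda>x. P x \<or> Q x)"
proof -
  have "decidable (\<lambda>x. \<not> (\<not> P x \<and> \<not> Q x))" by (intro recursive_intros assms)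
  then show ?thesis by simp
qed

lemma decidable_less [recursive_intros]:
  assumes "recursive f" "recursive g" shows "decidable (\<lambda>x. f x < g x)"
  unfolding not_le[symmetric] by (intro recursive_intros assms)

lemma decidable_eq [recursive_intros]:
  assumes "recursive f" "recursive g" shows "decidable (\<lambda>x. f x = g x)"
  unfolding order_eq_iff by (intro recursive_intros assms)

lemma decidable_subst:
  assumes "decidable (\<lambda>z. P (\<pi>1 z) (\<pi>2 z))" "recursive f" "recursive g"
  shows "decidable (\<lambda>x. P (f x) (g x))"
  using assms unfolding decidable_def by (rule recursive_subst)

lemma decidable_app:
  assumes "decidable P" "recursive f" shows "decidable (\<lambda>x. P (f x))"
  using assms unfolding decidable_def by (rule recursive_app)

lemma recursive_if [recursive_intros]:
  assumes "decidable P" "recursive f" "recursive g"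
  shows "recursive (\<lambda>x. if P x then f x else g x)"
proof -
  have "recursive (\<lambda>x. of_bool (P x) * f x + (1 - of_bool (P x)) * g x)"
    by (intro recursive_intros assms)
  moreover have "of_bool (P x) * f x + (1 - of_bool (P x)) * g x = (if P x then f x else g x)" for x
    by simp
  ultimately show ?thesis by (rule recursive_cong)
qed

lemma recursive_Least:
  assumes "decidable (\<lambda>p. P (\<pi>1 p) (\<pi>2 p))" "\<And>x. \<exists>n. P n x"
  shows "recursive (\<lambda>x. LEAST n. P n x)"
proof -
  have "recursive (\<lambda>p. if P (\<pi>1 p) (\<pi>2 p) then 0 else 1)"
    by (intro recursive_intros assms)
  then have "recursive2 (\<lambda>n x. if P n x then 0 else 1)"
    by (subst recursive2_iff)
  then have "computable (Suc 1) (\<lambda>xs. if P (xs ! 0) (xs ! 1) then 0 else 1)"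
    by (simp add: recursive2_def numeral_2_eq_2)
  then have "computable 1 (\<lambda>xs. LEAST n. (if P ((n # xs) ! 0) ((n # xs) ! 1) then 0 else 1) = (0::nat))"
    by (rule computable_Least) (use assms(2) in simp)
  moreover have "((if b then 0 else 1) = (0::nat)) = b" for b
    by simp
  ultimately show ?thesis by (simp add: recursive_def)
qed

text \<open>Counting is the basic bounded operation: bounded quantifiers say that a count vanishes, and the rank
of an element of a decidable set is a count.\<close>

lemma recursive_card [recursive_intros]:
  assumes "decidable (\<lambda>p. P (\<pi>1 p) (\<pi>2 p))" "recursive n"
  shows "recursive (\<lambda>x. card {m. m < n x \<and> P m x})"
proof -
  have "recursive (\<lambda>x. rec_nat 0 (\<lambda>m z. z + of_bool (P m x)) (n x))"
    by (intro recursive_intros assms decidable_subst[OF assms(1)])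
  moreover have "rec_nat 0 (\<lambda>m z. z + of_bool (P m x)) n = card {m. m < n \<and> P m x}" for n x
  proof (induction n)
    case (Suc n)
    have "{m. m < Suc n \<and> P m x} = (if P n x then {n} else {}) \<union> {m. m < n \<and> P m x}"
      by (auto simp: less_Suc_eq)
    then show ?case using Suc by auto
  qed simp
  ultimately show ?thesis by (rule recursive_cong)
qed

lemma decidable_bex_less [recursive_intros]:
  assumes "decidable (\<lambda>p. P (\<pi>1 p) (\<pi>2 p))" "recursive n"
  shows "decidable (\<lambda>x. \<exists>m<n x. P m x)"
proof -
  have "decidable (\<lambda>x. card {m. m < n x \<and> P m x} \<noteq> 0)"
    by (intro recursive_intros assms)
  moreover have "card {m. m < n x \<and> P m x} \<noteq> 0 \<longleftrightarrow> (\<exists>m<n x. P m x)" for x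
    by (auto simp: card_eq_0_iff)
  ultimately show ?thesis by simp
qed

lemma decidable_ball_less [recursive_intros]:
  assumes "decidable (\<lambda>p. P (\<pi>1 p) (\<pi>2 p))" "recursive n"
  shows "decidable (\<lambda>x. \<forall>m<n x. P m x)"
proof -
  have "decidable (\<lambda>x. \<not> (\<exists>m<n x. \<not> P m x))"
    by (intro recursive_intros assms)
  then show ?thesis by simp
qed

lemma recursive_max [recursive_intros]:
  assumes "recursive f" "recursive g" shows "recursive (\<lambda>x. max (f x) (g x))"
  unfolding max_def by (intro recursive_intros assms)

lemma recursive_Max [recursive_intros]:
  assumes "recursive (\<lambda>p. f (\<pi>1 p) (\<pi>2 p))" "recursive n"
  shows "recursive (\<lambda>x. MAX m\<in>{..n x}. f m x)"
proof -
  have "recursive (\<lambda>x. rec_nat (f 0 x) (\<lambda>m z. max (f (Suc m) x) z) (n x))"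
    by (intro recursive_intros recursive_subst[OF assms(1)] assms(2))
  moreover have "rec_nat (f 0 x) (\<lambda>m z. max (f (Suc m) x) z) n = (MAX m\<in>{..n}. f m x)" for n x
    by (induction n) (simp_all add: atMost_Suc)
  ultimately show ?thesis by (rule recursive_cong)
qed

section \<open>Computable and computably enumerable sets and relations\<close>

lemma ce_set_iff: "ce_set A \<longleftrightarrow> A = {} \<or> (\<exists>f. recursive f \<and> A = range f)"
  by (simp add: ce_set_def recursive_def)

lemma computable_rel_iff: "computable_rel R \<longleftrightarrow> decidable (\<lambda>z. prod_decode z \<in> R)"
  using recursive2_iff[of "\<lambda>x y. of_bool ((x, y) \<in> R)"]
  by (simp add: computable_rel_def decidable_def recursive2_def)

lemma ce_rel_iff:
  assumes "R \<noteq> {}"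
  shows "ce_rel R \<longleftrightarrow> (\<exists>g. recursive g \<and> R = range (\<lambda>n. prod_decode (g n)))"
proof -
  have *: "prod_encode ` R = range g \<longleftrightarrow> R = range (\<lambda>n. prod_decode (g n))" for g
  proof
    assume "prod_encode ` R = range g"
    then have "prod_decode ` prod_encode ` R = prod_decode ` range g" by simp
    then show "R = range (\<lambda>n. prod_decode (g n))" by (simp add: image_image)
  qed (simp add: image_image)
  show ?thesis using assms unfolding ce_rel_def ce_set_iff * by simp
qed

lemma ce_relI:
  assumes "recursive g" "R = range (\<lambda>n. prod_decode (g n))"
  shows "ce_rel R"
proof -
  have "R \<noteq> {}" using assms(2) by blast
  from ce_rel_iff[OF this] assms show ?thesis by blast
qed

text \<open>On an infinite set \<open>N\<close> the rank is the inverse of the increasing enumeration of \<open>N\<close>.\<close>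

definition rank :: "nat set \<Rightarrow> nat \<Rightarrow> nat" where
  "rank N n = card {m. m < n \<and> m \<in> N}"

lemma rank_enumerate:
  assumes "infinite N"
  shows "rank N (enumerate N a) = a"
proof -
  have "{m. m < enumerate N a \<and> m \<in> N} = enumerate N ` {..<a}"
  proof (intro equalityI subsetI)
    fix m assume "m \<in> {m. m < enumerate N a \<and> m \<in> N}"
    then obtain b where "m = enumerate N b" "enumerate N b < enumerate N a"
      using enumerate_Ex[of N] by (metis (mono_tags) assms mem_Collect_eq)
    then show "m \<in> enumerate N ` {..<a}"
      using assms by auto
  qed (use assms in \<open>auto intro: enumerate_in_set\<close>)
  moreover have "inj_on (enumerate N) {..<a}"
    using bij_enumerate[OF assms] by (auto simp: bij_betw_def intro: inj_on_subset)
  ultimately show ?thesis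
    by (simp add: rank_def card_image)
qed

lemma enumerate_rank: "infinite N \<Longrightarrow> n \<in> N \<Longrightarrow> enumerate N (rank N n) = n"
  by (metis enumerate_Ex rank_enumerate)

lemma recursive_rank:
  assumes "decidable (\<lambda>n. n \<in> N)"
  shows "recursive (rank N)"
proof -
  have "recursive (\<lambda>n. card {m. m < n \<and> m \<in> N})"
    by (intro recursive_intros decidable_app[OF assms])
  then show ?thesis by (simp add: rank_def[abs_def])
qed

lemma recursive_enumerate:
  assumes "infinite N" "decidable (\<lambda>n. n \<in> N)"
  shows "recursive (enumerate N)"
proof -
  have "recursive (\<lambda>a. LEAST n. n \<in> N \<and> rank N n = a)"
  proof (rule recursive_Least)
    show "\<exists>n. n \<in> N \<and> rank N n = a" for a
      using assms(1) by (intro exI[of _ "enumerate N a"]) (simp add: rank_enumerate enumerate_in_set)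
  qed (intro recursive_intros decidable_app[OF assms(2)] recursive_app[OF recursive_rank[OF assms(2)]])
  moreover have "(LEAST n. n \<in> N \<and> rank N n = a) = enumerate N a" for a
    by (rule Least_equality)
      (use assms(1) in \<open>auto simp: rank_enumerate enumerate_in_set enumerate_rank\<close>)
  ultimately show ?thesis by (rule recursive_cong)
qed

lemma ce_set_if_decidable:
  assumes "decidable (\<lambda>n. n \<in> N)"
  shows "ce_set N"
proof (cases "N = {}")
  case False
  then obtain a where a: "a \<in> N" by blast
  have "recursive (\<lambda>n. if n \<in> N then n else a)"
    by (intro recursive_intros assms)
  moreover have "N = range (\<lambda>n. if n \<in> N then n else a)"
    using a by auto
  ultimately show ?thesis unfolding ce_set_iff by blast
qed (simp add: ce_set_def)

text \<open>Given an enumeration \<open>f\<close>, the indices at which \<open>f\<close> takes a new value form a decidable set, on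
which \<open>f\<close> is injective; enumerating that set in increasing order removes the repetitions.\<close>

lemma infinite_ce_set_bij:
  assumes "ce_set A" "infinite A"
  obtains e where "recursive e" "bij_betw e UNIV A"
proof -
  obtain f where f: "recursive f" "A = range f"
    using assms by (auto simp: ce_set_iff)
  define N where "N = {n. \<forall>m<n. f m \<noteq> f n}"
  have bij: "bij_betw f N A"
  proof (rule bij_betw_imageI)
    show "inj_on f N"
      by (rule inj_onI) (metis (mono_tags, lifting) N_def linorder_neqE_nat mem_Collect_eq)
    show "f ` N = A"
    proof (intro equalityI subsetI)
      fix a assume "a \<in> A"
      then have *: "\<exists>n. f n = a" using f by auto
      define n where "n = (LEAST n. f n = a)"
      have "f n = a" unfolding n_def using * by (rule LeastI_ex)
      moreover have "f m \<noteq> a" if "m < n" for m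
        using that unfolding n_def by (rule not_less_Least)
      then have "n \<in> N"
        using \<open>f n = a\<close> by (simp add: N_def)
      ultimately show "a \<in> f ` N" by blast
    qed (auto simp: f)
  qed
  then have N: "infinite N"
    using assms(2) bij_betw_finite by blast
  have "decidable (\<lambda>n. \<forall>m<n. f m \<noteq> f n)"
    by (intro recursive_intros recursive_app[OF f(1)])
  then have "recursive (enumerate N)"
    by (intro recursive_enumerate N) (simp add: N_def)
  then have "recursive (\<lambda>n. f (enumerate N n))"
    by (rule recursive_app[OF f(1)])
  moreover have "bij_betw (\<lambda>n. f (enumerate N n)) UNIV A"
    using bij_betw_trans[OF bij_enumerate[OF N] bij] by (simp add: comp_def)
  ultimately show ?thesis by (rule that)
qed

text \<open>The new relation is enumerated by searching through all triples of an index of \<open>S\<close> and a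
candidate pair. Reflexivity at \<open>0\<close> supplies a harmless output for the triples that do not match.\<close>

lemma ce_rel_pullback:
  assumes "ce_rel S" "recursive e" "(e 0, e 0) \<in> S"
  shows "ce_rel {(i, j). (e i, e j) \<in> S}"
proof -
  have "S \<noteq> {}" using assms(3) by blast
  then obtain g where g: "recursive g" "S = range (\<lambda>n. prod_decode (g n))"
    using assms(1) by (auto simp: ce_rel_iff)
  let ?i = "\<lambda>z. \<pi>1 (\<pi>2 z)" and ?j = "\<lambda>z. \<pi>2 (\<pi>2 z)"
  let ?k = "\<lambda>z. if g (\<pi>1 z) = prod_encode (e (?i z), e (?j z)) then prod_encode (?i z, ?j z)
    else prod_encode (0, 0)"
  have "recursive ?k"
    by (intro recursive_intros recursive_app[OF g(1)] recursive_app[OF assms(2)])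
  moreover have "{(i, j). (e i, e j) \<in> S} = range (\<lambda>z. prod_decode (?k z))"
  proof (intro equalityI subsetI)
    fix p assume "p \<in> {(i, j). (e i, e j) \<in> S}"
    then obtain i j where p: "p = (i, j)" "(e i, e j) \<in> S" by blast
    then obtain n where n: "(e i, e j) = prod_decode (g n)" using g by blast
    have "p = prod_decode (?k (prod_encode (n, prod_encode (i, j))))"
      by (simp add: p n)
    then show "p \<in> range (\<lambda>z. prod_decode (?k z))" by blast
  next
    fix p assume "p \<in> range (\<lambda>z. prod_decode (?k z))"
    then obtain z where "p = prod_decode (?k z)" by blast
    moreover have "prod_decode (g (\<pi>1 z)) \<in> S" using g by blast
    ultimately show "p \<in> {(i, j). (e i, e j) \<in> S}"
      using assms(3) by (auto split: if_splits)
  qed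
  ultimately show ?thesis by (rule ce_relI)
qed

section \<open>Copies of equivalence structures\<close>

lemma equiv_pullback:
  assumes "equiv B S" "range e \<subseteq> B"
  shows "equiv UNIV {(i, j). (e i, e j) \<in> S}"
proof (rule equivI)
  show "refl {(i, j). (e i, e j) \<in> S}"
    using assms by (auto simp: equiv_def refl_on_def)
  show "sym {(i, j). (e i, e j) \<in> S}"
    using assms by (auto simp: equiv_def sym_def)
  show "trans {(i, j). (e i, e j) \<in> S}"
    using assms by (auto simp: equiv_def trans_def)
qed simp

text \<open>All copies below arise in this way: \<open>k\<close> identifies the given structure with a part \<open>B\<close> of a
known structure \<open>S\<close>, and \<open>e\<close> renames the elements of \<open>B\<close> as natural numbers.\<close>

lemma is_copy_pullback:
  assumes "equiv C S" "B \<subseteq> C" "bij_betw e UNIV B" "bij_betw k A B"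
    and iso: "\<And>x y. x \<in> A \<Longrightarrow> y \<in> A \<Longrightarrow> (x, y) \<in> R \<longleftrightarrow> (k x, k y) \<in> S"
  shows "is_copy A R {(i, j). (e i, e j) \<in> S}"
  unfolding is_copy_def
proof (intro conjI exI ballI)
  show "equiv UNIV {(i, j). (e i, e j) \<in> S}"
    using assms by (intro equiv_pullback[of C]) (auto simp: bij_betw_def)
  show "bij_betw (inv_into UNIV e \<circ> k) A UNIV"
    by (rule bij_betw_trans[OF assms(4) bij_betw_inv_into[OF assms(3)]])
  fix x y assume xy: "x \<in> A" "y \<in> A"
  then have "k x \<in> B" "k y \<in> B" using assms(4) by (auto simp: bij_betw_def)
  then show "(x, y) \<in> R \<longleftrightarrow> ((inv_into UNIV e \<circ> k) x, (inv_into UNIV e \<circ> k) y) \<in> {(i, j). (e i, e j) \<in> S}"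
    using iso[OF xy] assms(3) by (simp add: bij_betw_inv_into_right)
qed

section \<open>Asymptotic density\<close>

lemma infinite_if_density_1:
  assumes "has_density A 1"
  shows "infinite A"
proof
  assume A: "finite A"
  have "(\<lambda>n. real (card A) * inverse (real (Suc n))) \<longlonglongrightarrow> real (card A) * 0"
    by (intro tendsto_intros LIMSEQ_inverse_real_of_nat)
  then have lim: "(\<lambda>n. real (card A) * inverse (real (Suc n))) \<longlonglongrightarrow> 0" by simp
  have bound: "real (card (A \<inter> {0..n})) / real (n + 1) \<le> real (card A) * inverse (real (Suc n))" for n
  proof -
    have "card (A \<inter> {0..n}) \<le> card A" using A by (intro card_mono) auto
    then show ?thesis by (simp add: divide_inverse mult_right_mono)
  qed
  have "(\<lambda>n. real (card (A \<inter> {0..n})) / real (n + 1)) \<longlonglongrightarrow> 0"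
    by (rule tendsto_sandwich[OF _ _ tendsto_const lim]; intro always_eventually allI)
      (rule divide_nonneg_nonneg bound; simp)+
  with assms show False
    unfolding has_density_def using LIMSEQ_unique by fastforce
qed

text \<open>The bound is loose enough to cover both a finite complement and the set of squares.\<close>

lemma density_1_if_sparse_complement:
  assumes "\<And>n. real (card (- D \<inter> {0..n})) \<le> c * sqrt (real (n + 1))"
  shows "has_density D 1"
proof -
  have "(\<lambda>n. c * sqrt (inverse (real (Suc n)))) \<longlonglongrightarrow> c * sqrt 0"
    by (intro tendsto_intros LIMSEQ_inverse_real_of_nat)
  then have lim: "(\<lambda>n. c * sqrt (inverse (real (Suc n)))) \<longlonglongrightarrow> 0" by simp
  have bound: "real (card (- D \<inter> {0..n})) / real (n + 1) \<le> c * sqrt (inverse (real (Suc n)))" for n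
  proof -
    have "real (card (- D \<inter> {0..n})) / real (n + 1) \<le> c * sqrt (real (n + 1)) / real (n + 1)"
      by (intro divide_right_mono assms) simp
    also have "\<dots> = c * (sqrt (real (n + 1)) / real (n + 1))" by simp
    also have "sqrt (real (n + 1)) / real (n + 1) = inverse (sqrt (real (n + 1)))"
      using sqrt_divide_self_eq[of "real (n + 1)"] by simp
    finally show ?thesis by (simp add: real_sqrt_inverse)
  qed
  have "(\<lambda>n. real (card (- D \<inter> {0..n})) / real (n + 1)) \<longlonglongrightarrow> 0"
    by (rule tendsto_sandwich[OF _ _ tendsto_const lim]; intro always_eventually allI)
      (rule divide_nonneg_nonneg bound; simp)+
  then have "(\<lambda>n. 1 - real (card (- D \<inter> {0..n})) / real (n + 1)) \<longlonglongrightarrow> 1 - 0"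
    by (intro tendsto_intros)
  moreover have "1 - real (card (- D \<inter> {0..n})) / real (n + 1) = real (card (D \<inter> {0..n})) / real (n + 1)" for n
  proof -
    have "card (D \<inter> {0..n}) + card (- D \<inter> {0..n}) = card (D \<inter> {0..n} \<union> - D \<inter> {0..n})"
      by (intro card_Un_disjoint[symmetric]) auto
    also have "D \<inter> {0..n} \<union> - D \<inter> {0..n} = {0..n}" by auto
    finally have "real (card (D \<inter> {0..n})) + real (card (- D \<inter> {0..n})) = real (n + 1)"
      by (simp flip: of_nat_add)
    then show ?thesis by (simp add: field_simps)
  qed
  ultimately show ?thesis by (simp add: has_density_def)
qed

text \<open>A prescribed finite cardinality of the complement is realised by an initial segment, and a countably
infinite one by the squares.\<close>

lemma decidable_density_1_with_complement:
  fixes B :: "nat set"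
  obtains D q where "decidable (\<lambda>n. n \<in> D)" "has_density D 1" "bij_betw q B (- D)"
proof (cases "finite B")
  case True
  define D where "D = {n. card B \<le> n}"
  have "decidable (\<lambda>n. n \<in> D)"
    unfolding D_def mem_Collect_eq by (intro recursive_intros)
  moreover have "has_density D 1"
  proof (rule density_1_if_sparse_complement)
    fix n
    have "card (- D \<inter> {0..n}) \<le> card {..<card B}"
      by (intro card_mono) (auto simp: D_def)
    then have "real (card (- D \<inter> {0..n})) \<le> real (card B) * 1" by simp
    also have "\<dots> \<le> real (card B) * sqrt (real (n + 1))"
      by (intro mult_left_mono) auto
    finally show "real (card (- D \<inter> {0..n})) \<le> real (card B) * sqrt (real (n + 1))" .
  qed
  moreover have "\<exists>q. bij_betw q B (- D)"
  proof -
    have "- D = {..<card B}" by (auto simp: D_def)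
    then show ?thesis by (intro finite_same_card_bij) (simp_all add: True)
  qed
  ultimately show ?thesis using that by blast
next
  case False
  define sq :: "nat \<Rightarrow> nat" where "sq = (\<lambda>m. m * m)"
  define D where "D = - range sq"
  have "decidable (\<lambda>n. \<not> (\<exists>m<Suc n. m * m = n))"
    by (intro recursive_intros)
  moreover have "n \<in> D \<longleftrightarrow> \<not> (\<exists>m<Suc n. m * m = n)" for n
  proof -
    have "m < Suc n" if "m * m = n" for m
      using that le_square[of m] by (simp add: less_Suc_eq_le)
    then show ?thesis unfolding D_def sq_def by blast
  qed
  ultimately have "decidable (\<lambda>n. n \<in> D)" by simp
  moreover have "has_density D 1"
  proof (rule density_1_if_sparse_complement)
    fix n
    define r where "r = nat \<lfloor>sqrt (real n)\<rfloor>"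
    have "- D \<inter> {0..n} \<subseteq> sq ` {..r}"
    proof
      fix x assume "x \<in> - D \<inter> {0..n}"
      then obtain m where m: "x = m * m" "m * m \<le> n" by (auto simp: D_def sq_def)
      have "real m * real m \<le> real n"
        using m(2) by (simp flip: of_nat_mult)
      then have "real m \<le> sqrt (real n)"
        by (intro real_le_rsqrt) (simp add: power2_eq_square)
      then have "m \<le> r" by (simp add: r_def le_nat_floor)
      then show "x \<in> sq ` {..r}" by (auto simp: m sq_def)
    qed
    then have "card (- D \<inter> {0..n}) \<le> card (sq ` {..r})"
      by (intro card_mono) auto
    also have "\<dots> \<le> Suc r"
      using card_image_le[of "{..r}" sq] by simp
    finally have "real (card (- D \<inter> {0..n})) \<le> 1 + real r" by simp
    moreover have "real r \<le> sqrt (real n)" by (simp add: r_def)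
    moreover have "sqrt (real n) \<le> sqrt (real (n + 1))" by simp
    moreover have "1 \<le> sqrt (real (n + 1))" by simp
    ultimately show "real (card (- D \<inter> {0..n})) \<le> 2 * sqrt (real (n + 1))" by linarith
  qed
  moreover have "infinite (- D)"
    unfolding D_def double_complement
    by (rule range_inj_infinite) (auto simp: inj_on_def sq_def intro: power2_eq_imp_eq simp flip: power2_eq_square)
  then have "bij_betw (enumerate (- D) \<circ> inv_into UNIV (enumerate B)) B (- D)"
    using False by (intro bij_betw_trans[OF bij_betw_inv_into[OF bij_enumerate] bij_enumerate])
  ultimately show ?thesis by (rule that)
qed

section \<open>Generic copies and faithful substructures\<close>

text \<open>The partial function first searches for indices of both arguments in the enumeration of the c.e. set
and only then evaluates the computable relation, so it converges exactly on the square of that set.\<close>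

lemma faithfully_generically_computable_if_strongly:
  assumes "faithfully_strongly_generically_computable R"
  shows "faithfully_generically_computable R"
proof -
  obtain S A where S: "equiv UNIV S" "computable_rel S" "ce_set A" "has_density A 1"
    "agree_on A R S" "faithful R A"
    using assms unfolding faithfully_strongly_generically_computable_def by blast
  then obtain f where f: "recursive f" "A = range f"
    using infinite_if_density_1[of A] by (auto simp: ce_set_iff)
  define \<Phi> where "\<Phi> x y = (if x \<in> A \<and> y \<in> A then Some (of_bool ((x, y) \<in> S) :: nat) else None)" for x y
  have "computable 3 (\<lambda>xs. if f (\<pi>1 (xs ! 0)) = xs ! 1 \<and> f (\<pi>2 (xs ! 0)) = xs ! 2 then 0 else 1)"
    by (rule computable_3I[where F = "\<lambda>t x y. if f (\<pi>1 t) = x \<and> f (\<pi>2 t) = y then 0 else 1"])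
      (intro recursive_intros recursive_app[OF f(1)])
  then obtain m where m: "\<forall>xs. length xs = 3 \<longrightarrow> eval m xs
      = Some (if f (\<pi>1 (xs ! 0)) = xs ! 1 \<and> f (\<pi>2 (xs ! 0)) = xs ! 2 then 0 else 1)"
    by (rule computableE)
  have "computable 3 (\<lambda>xs. of_bool (prod_decode (prod_encode (xs ! 1, xs ! 2)) \<in> S))"
    by (rule computable_3I[where F = "\<lambda>t x y. of_bool (prod_decode (prod_encode (x, y)) \<in> S)"])
      (intro recursive_intros decidable_app[OF S(2)[unfolded computable_rel_iff]])
  then have "computable 3 (\<lambda>xs. of_bool ((xs ! 1, xs ! 2) \<in> S))" by simp
  then obtain p where p: "\<forall>xs. length xs = 3 \<longrightarrow> eval p xs = Some (of_bool ((xs ! 1, xs ! 2) \<in> S))"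
    by (rule computableE)
  have eval_\<Phi>: "eval (Comp p [Mu m, Proj 0, Proj 1]) [x, y] = \<Phi> x y" for x y
  proof -
    have match: "eval m [t, x, y] = Some (if f (\<pi>1 t) = x \<and> f (\<pi>2 t) = y then 0 else 1)" for t
      using m by simp
    show ?thesis
    proof (cases "x \<in> A \<and> y \<in> A")
      case True
      then obtain i j where "x = f i" "y = f j" using f(2) by blast
      then have "eval m [prod_encode (i, j), x, y] = Some 0"
        using match[of "prod_encode (i, j)"] by simp
      then have "\<exists>t. eval m [t, x, y] = Some 0" ..
      then obtain t where "eval (Mu m) [x, y] = Some t"
        by (simp add: match)
      then show ?thesis using p True by (simp add: \<Phi>_def)
    next
      case False
      then have "\<not> (\<exists>t. eval m [t, x, y] = Some 0)"
        using f(2) by (auto simp: match)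
      then have "eval (Mu m) [x, y] = None" by simp
      then show ?thesis using False by (simp add: \<Phi>_def)
    qed
  qed
  have "partial_computable 2 (\<lambda>xs. \<Phi> (xs ! 0) (xs ! 1))"
    unfolding partial_computable_def
  proof (intro exI allI impI)
    fix xs :: "nat list" assume "length xs = 2"
    then obtain x y where "xs = [x, y]" by (auto simp: length_Suc_conv numeral_2_eq_2)
    with eval_\<Phi>[of x y] show "eval (Comp p [Mu m, Proj 0, Proj 1]) xs = \<Phi> (xs ! 0) (xs ! 1)"
      by (simp del: eval.simps)
  qed
  moreover have "\<forall>x y v. \<Phi> x y = Some v \<longrightarrow> v = of_bool ((x, y) \<in> R)"
    using S(5) by (auto simp: \<Phi>_def agree_on_def)
  moreover have "\<forall>x\<in>A. \<forall>y\<in>A. \<Phi> x y \<noteq> None"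
    by (simp add: \<Phi>_def)
  ultimately show ?thesis
    unfolding faithfully_generically_computable_def using S(3,4,6) by blast
qed

text \<open>The witness is the restriction of \<open>R\<close> to the c.e. set. It is c.e. because the partial function,
composed with an enumeration of that set, is total and decides \<open>R\<close> between enumerated elements.\<close>

lemma faithfully_generically_ce_if_computable:
  assumes "equiv UNIV R" "faithfully_generically_computable R"
  shows "faithfully_generically_ce R"
proof -
  obtain \<Phi> A where A: "partial_computable 2 (\<lambda>xs. \<Phi> (xs ! 0) (xs ! 1))"
    "\<And>x y v. \<Phi> x y = Some v \<Longrightarrow> v = of_bool ((x, y) \<in> R)"
    "ce_set A" "has_density A 1" "\<And>x y. x \<in> A \<Longrightarrow> y \<in> A \<Longrightarrow> \<Phi> x y \<noteq> None" "faithful R A"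
    using assms(2) unfolding faithfully_generically_computable_def by blast
  then obtain f where f: "recursive f" "A = range f"
    using infinite_if_density_1[of A] by (auto simp: ce_set_iff)
  obtain p where p: "\<forall>xs. length xs = 2 \<longrightarrow> eval p xs = \<Phi> (xs ! 0) (xs ! 1)"
    using A(1) unfolding partial_computable_def by blast
  obtain q where q: "\<forall>xs. length xs = 1 \<longrightarrow> eval q xs = Some (f (xs ! 0))"
    using f(1) unfolding recursive_def by (rule computableE)
  have \<Phi>: "\<Phi> (f i) (f j) = Some (of_bool ((f i, f j) \<in> R))" for i j
  proof -
    have "f i \<in> A" "f j \<in> A" using f(2) by blast+
    then obtain v where "\<Phi> (f i) (f j) = Some v" using A(5) by blast
    with A(2) show ?thesis by metis
  qed
  have "eval (Comp p [Comp q [Proj 0], Comp q [Proj 1]]) xs = Some (of_bool ((f (xs ! 0), f (xs ! 1)) \<in> R))"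
    if "length xs = 2" for xs
    using that p q by (simp add: \<Phi>)
  then have "recursive2 (\<lambda>i j. of_bool ((f i, f j) \<in> R))"
    unfolding recursive2_def by (rule computableI)
  then have R: "decidable (\<lambda>z. (f (\<pi>1 z), f (\<pi>2 z)) \<in> R)"
    by (simp add: decidable_def recursive2_iff)
  define S where "S = R \<inter> A \<times> A"
  let ?g = "\<lambda>z. if (f (\<pi>1 z), f (\<pi>2 z)) \<in> R then prod_encode (f (\<pi>1 z), f (\<pi>2 z))
    else prod_encode (f (\<pi>1 z), f (\<pi>1 z))"
  have "recursive ?g"
    by (intro recursive_intros R recursive_app[OF f(1)])
  moreover have "S = range (\<lambda>z. prod_decode (?g z))"
  proof (intro equalityI subsetI)
    fix u assume "u \<in> S"
    then obtain i j where "u = (f i, f j)" "(f i, f j) \<in> R"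
      by (auto simp: S_def f(2))
    then have "u = prod_decode (?g (prod_encode (i, j)))" by simp
    then show "u \<in> range (\<lambda>z. prod_decode (?g z))" by blast
  next
    have "(x, x) \<in> R" for x
      using assms(1) by (auto simp: equiv_def refl_on_def)
    then show "u \<in> S" if "u \<in> range (\<lambda>z. prod_decode (?g z))" for u
      using that by (auto simp: S_def f(2))
  qed
  ultimately have "ce_rel S" by (rule ce_relI)
  moreover have "equiv A S"
    using assms(1) unfolding S_def equiv_def refl_on_def sym_def trans_def by blast
  moreover have "agree_on A R S" "faithful S A"
    by (auto simp: agree_on_def faithful_def S_def)
  ultimately show ?thesis
    unfolding faithfully_generically_ce_def using A(3,4,6) by blast
qed

text \<open>The substructure is the preimage of the density 1 set under the isomorphism onto the copy.\<close>

lemma ce_substructure_if_generically_ce_copy: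
  assumes "has_copy_with faithfully_generically_ce UNIV E"
  shows "has_inf_faithful_substructure_with ce_rel E"
proof -
  obtain R' where R': "is_copy UNIV E R'" "faithfully_generically_ce R'"
    using assms unfolding has_copy_with_def by blast
  obtain h where h: "bij h" "\<And>x y. (x, y) \<in> E \<longleftrightarrow> (h x, h y) \<in> R'"
    using R'(1) unfolding is_copy_def by blast
  obtain S B A where S: "equiv B S" "ce_rel S" "ce_set A" "A \<subseteq> B" "has_density A 1"
    "agree_on A R' S" "faithful R' A"
    using R'(2) unfolding faithfully_generically_ce_def by blast
  have "infinite A" by (rule infinite_if_density_1) (rule S(5))
  with S(3) obtain e where e: "recursive e" "bij_betw e UNIV A"
    by (rule infinite_ce_set_bij)
  define A' where "A' = h -` A"
  have bij: "bij_betw h A' A"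
    using h(1) unfolding A'_def
    by (auto simp: bij_betw_def inj_on_def surj_image_vimage_eq)
  then have "infinite A'" using \<open>infinite A\<close> bij_betw_finite by blast
  moreover have "faithful E A'"
    using S(7) unfolding faithful_def A'_def by (auto simp: h(2))
  moreover have "is_copy A' (E \<inter> A' \<times> A') {(i, j). (e i, e j) \<in> S}"
  proof (rule is_copy_pullback[OF S(1) S(4) e(2) bij])
    fix x y assume "x \<in> A'" "y \<in> A'"
    then have "h x \<in> A" "h y \<in> A" by (auto simp: A'_def)
    then show "(x, y) \<in> E \<inter> A' \<times> A' \<longleftrightarrow> (h x, h y) \<in> S"
      using S(6) \<open>x \<in> A'\<close> \<open>y \<in> A'\<close> by (auto simp: agree_on_def h(2))
  qed
  moreover have "ce_rel {(i, j). (e i, e j) \<in> S}"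
  proof (rule ce_rel_pullback[OF S(2) e(1)])
    have "e 0 \<in> B" using e(2) S(4) by (auto simp: bij_betw_def)
    then show "(e 0, e 0) \<in> S" using S(1) by (auto simp: equiv_def refl_on_def)
  qed
  ultimately show ?thesis
    unfolding has_inf_faithful_substructure_with_def has_copy_with_def by blast
qed

text \<open>The part \<open>A\<close> is placed on \<open>D\<close> in increasing order, following its computable copy, and the
remaining elements go to the complement of \<open>D\<close> by an arbitrary bijection. That bijection, and the
relation of the copy outside \<open>D\<close>, may be far from computable: agreement with a computable relation
is demanded on \<open>D\<close> only.\<close>

lemma strongly_generic_copy_if_computable_substructure:
  assumes "equiv UNIV E" "has_inf_faithful_substructure_with computable_rel E"
  shows "has_copy_with faithfully_strongly_generically_computable UNIV E"
proof -
  obtain A R0 where A: "infinite A" "faithful E A" "is_copy A (E \<inter> A \<times> A) R0" "computable_rel R0"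
    using assms(2) unfolding has_inf_faithful_substructure_with_def has_copy_with_def by blast
  obtain h where h: "bij_betw h A UNIV"
    "\<And>x y. x \<in> A \<Longrightarrow> y \<in> A \<Longrightarrow> (x, y) \<in> E \<longleftrightarrow> (h x, h y) \<in> R0"
    using A(3) unfolding is_copy_def by blast
  have R0: "equiv UNIV R0" using A(3) by (simp add: is_copy_def)
  obtain D q where D: "decidable (\<lambda>n. n \<in> D)" "has_density D 1" "bij_betw q (- A) (- D)"
    by (rule decidable_density_1_with_complement)
  have inf: "infinite D" by (rule infinite_if_density_1) (rule D(2))
  \<comment> \<open>\<open>H\<close> is the isomorphism onto the copy; it maps \<open>A\<close> onto \<open>D\<close>.\<close>
  define H where "H x = (if x \<in> A then enumerate D (h x) else q x)" for x
  have HA: "bij_betw H A D"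
    using bij_betw_trans[OF h(1) bij_enumerate[OF inf]]
    by (rule bij_betw_cong[THEN iffD1, rotated]) (simp add: H_def)
  have "bij_betw H (- A) (- D)"
    using D(3) by (rule bij_betw_cong[THEN iffD1, rotated]) (simp add: H_def)
  from bij_betw_combine[OF HA this] have H: "bij H" by simp
  define G where "G = inv_into UNIV H"
  have G: "bij G" "\<And>x. G (H x) = x" "\<And>y. H (G y) = y"
    using H by (auto simp: G_def bij_imp_bij_inv bij_is_inj bij_is_surj surj_f_inv_f)
  have HD: "H x \<in> D \<longleftrightarrow> x \<in> A" for x
    using HA \<open>bij_betw H (- A) (- D)\<close> by (auto simp: bij_betw_def)
  then have GA: "G y \<in> A \<longleftrightarrow> y \<in> D" for y
    using G(3) by metis
  define R' where "R' = {(i, j). (G i, G j) \<in> E}"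
  have "is_copy UNIV E R'"
    unfolding R'_def using is_copy_pullback[OF assms(1) subset_UNIV G(1) bij_id] by simp
  moreover have "faithfully_strongly_generically_computable R'"
  proof -
    \<comment> \<open>Outside \<open>D\<close> one class suffices to make \<open>S\<close> an equivalence relation for which \<open>D\<close> is faithful.\<close>
    define S where "S = {(u, v). (u \<in> D \<and> v \<in> D \<and> (rank D u, rank D v) \<in> R0) \<or> (u \<notin> D \<and> v \<notin> D)}"
    have "equiv UNIV S"
      using R0 unfolding S_def equiv_def refl_on_def sym_def trans_def by blast
    moreover have "computable_rel S"
    proof -
      have "decidable (\<lambda>z. (\<pi>1 z \<in> D \<and> \<pi>2 z \<in> D
          \<and> prod_decode (prod_encode (rank D (\<pi>1 z), rank D (\<pi>2 z))) \<in> R0) \<or> (\<pi>1 z \<notin> D \<and> \<pi>2 z \<notin> D))"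
        by (intro recursive_intros decidable_app[OF D(1)] recursive_app[OF recursive_rank[OF D(1)]]
            decidable_app[OF A(4)[unfolded computable_rel_iff]])
      then show ?thesis
        by (simp add: computable_rel_iff S_def case_prod_unfold)
    qed
    moreover have "ce_set D" by (rule ce_set_if_decidable) (rule D(1))
    moreover have "agree_on D R' S"
    proof -
      have "(u, v) \<in> R' \<longleftrightarrow> (u, v) \<in> S" if "u \<in> D" "v \<in> D" for u v
      proof -
        have "rank D u = h (G u)" if "u \<in> D" for u
        proof -
          have "u = enumerate D (h (G u))"
            using G(3)[of u] that by (simp add: H_def GA)
          then show ?thesis using rank_enumerate[OF inf] by metis
        qed
        then show ?thesis
          using that by (simp add: R'_def S_def h(2) GA)
      qed
      then show ?thesis by (auto simp: agree_on_def)
    qed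
    moreover have "faithful R' D"
      using A(2) unfolding faithful_def R'_def by (auto simp flip: GA)
    moreover have "faithful S D"
      unfolding faithful_def S_def by auto
    ultimately show ?thesis
      unfolding faithfully_strongly_generically_computable_def using D(2) by blast
  qed
  ultimately show ?thesis unfolding has_copy_with_def by blast
qed

section \<open>Functions with increasing limits\<close>

lemma tendsto_nat_iff: "(f :: nat \<Rightarrow> nat) \<longlonglongrightarrow> l \<longleftrightarrow> (\<forall>\<^sub>F s in sequentially. f s = l)"
  by (rule tendsto_discrete)

lemma s1_function_eventually:
  assumes "s1_function f"
  shows "\<forall>\<^sub>F s in sequentially. f i s = lim (f i)"
  using assms unfolding s1_function_def by (simp add: convergent_LIMSEQ_iff tendsto_nat_iff)

lemma s1_function_le_lim:
  assumes "s1_function f"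
  shows "f i s \<le> lim (f i)"
proof -
  obtain t where t: "\<And>r. t \<le> r \<Longrightarrow> f i r = lim (f i)"
    using s1_function_eventually[OF assms, of i] by (auto simp: eventually_sequentially)
  have "f i r \<le> f i (Suc r)" for r
    using assms by (simp add: s1_function_def)
  then have "f i s \<le> f i (max s t)"
    by (rule lift_Suc_mono_le) simp
  then show ?thesis using t[of "max s t"] by simp
qed

lemma s1_function_inj_lim:
  assumes "s1_function f"
  shows "inj (\<lambda>i. lim (f i))"
  using assms unfolding s1_function_def
  by (intro strict_mono_imp_inj_on) (simp add: strict_mono_Suc_iff)

text \<open>The required subset consists of the pairs \<open>(m\<^sub>i, 1)\<close> alone. It is infinite because the limits
\<open>m\<^sub>i\<close> increase strictly, and it is \<open>\<Sigma>\<^sup>0\<^sub>2\<close> because \<open>x\<close> is a limit iff some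
\<open>f i\<close> takes the value \<open>x\<close> from some stage \<open>t\<close> on; the code \<open>u\<close> stands for \<open>(i, t)\<close>.\<close>

lemma computable_s1_conditionI:
  assumes "recursive2 f" "s1_function f" "\<And>i. (lim (f i), 1) \<in> X"
  shows "computable_s1_condition X"
proof -
  define K where "K = range (\<lambda>i. (lim (f i), 1::nat))"
  have "infinite K"
    unfolding K_def
    using s1_function_inj_lim[OF assms(2)] by (intro range_inj_infinite) (auto simp: inj_def)
  moreover have "Sigma02_rel K"
    unfolding Sigma02_rel_def
  proof (intro exI conjI allI)
    let ?Q = "\<lambda>x y u v. y = 1 \<and> f (\<pi>1 u) (\<pi>2 u + v) = x"
    have f: "recursive (\<lambda>z. f (\<pi>1 z) (\<pi>2 z))"
      using assms(1) by (simp add: recursive2_iff)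
    show "computable 4 (\<lambda>xs. of_bool (?Q (xs ! 0) (xs ! 1) (xs ! 2) (xs ! 3)))"
      by (intro computable_4I[where F = "\<lambda>x y u v. of_bool (?Q x y u v)"] recursive_intros recursive_subst[OF f])
    show "(x, y) \<in> K \<longleftrightarrow> (\<exists>u. \<forall>v. ?Q x y u v)" for x y
    proof
      assume "(x, y) \<in> K"
      then obtain i where i: "x = lim (f i)" "y = 1" by (auto simp: K_def)
      obtain t where "\<And>r. t \<le> r \<Longrightarrow> f i r = lim (f i)"
        using s1_function_eventually[OF assms(2), of i] by (auto simp: eventually_sequentially)
      then have "\<forall>v. ?Q x y (prod_encode (i, t)) v" by (simp add: i)
      then show "\<exists>u. \<forall>v. ?Q x y u v" by blast
    next
      assume "\<exists>u. \<forall>v. ?Q x y u v"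
      then obtain u where u: "y = 1" "\<And>v. f (\<pi>1 u) (\<pi>2 u + v) = x" by blast
      obtain t where "\<And>r. t \<le> r \<Longrightarrow> f (\<pi>1 u) r = lim (f (\<pi>1 u))"
        using s1_function_eventually[OF assms(2), of "\<pi>1 u"] by (auto simp: eventually_sequentially)
      from this[of "\<pi>2 u + t"] u(2)[of t] have "x = lim (f (\<pi>1 u))" by simp
      with u(1) show "(x, y) \<in> K" by (auto simp: K_def)
    qed
  qed
  moreover have "computable 2 (\<lambda>xs. f (xs ! 0) (xs ! 1))"
    using assms(1) by (simp add: recursive2_def)
  moreover have "possesses_s1 K f"
    using assms(2) by (simp add: possesses_s1_def K_def)
  moreover have "K \<subseteq> X" using assms(3) by (auto simp: K_def)
  ultimately show ?thesis unfolding computable_s1_condition_def by blast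
qed

text \<open>For each \<open>m\<close>, searching through codes \<open>w = (x, t)\<close> finds one with \<open>m < c x t\<close>, and hence an
\<open>x\<close> with \<open>m < L x\<close>. Iterating a map from \<open>m\<close> to such a value produces increasing values, but
it has to be applied to approximations of \<open>m\<close>, so it should be monotone in \<open>m\<close> to keep the
iterates nondecreasing in the stage. Taking the maximum over all \<open>k \<le> m\<close> of the values found for
\<open>k\<close> achieves this: the maximum \<open>B m s\<close> exceeds \<open>m\<close>, is monotone in \<open>m\<close> and in the stage
\<open>s\<close>, and converges to one of the values of \<open>L\<close>. The \<open>i\<close>-th iterate of \<open>B _ s\<close> is then
the desired function.\<close>

lemma s1_function_from_approximation:
  assumes c: "recursive2 c"
    and mono: "\<And>x s. c x s \<le> c x (Suc s)"
    and lim: "\<And>x. \<forall>\<^sub>F s in sequentially. c x s = L x"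
    and unbounded: "\<And>m. \<exists>x. m < L x"
  obtains f where "recursive2 f" "s1_function f" "\<forall>i. lim (f i) \<in> range L"
proof -
  have mono': "s \<le> t \<Longrightarrow> c x s \<le> c x t" for x s t
    using mono by (rule lift_Suc_mono_le)
  have c': "recursive (\<lambda>z. c (\<pi>1 z) (\<pi>2 z))"
    using c by (simp add: recursive2_iff)
  \<comment> \<open>The search runs over codes, so that a suitable \<open>x\<close> and a stage confirming it are found together.\<close>
  define w where "w m = (LEAST z. m < c (\<pi>1 z) (\<pi>2 z))" for m
  have ex: "\<exists>z. m < c (\<pi>1 z) (\<pi>2 z)" for m
  proof -
    obtain x where "m < L x" using unbounded by blast
    moreover obtain s where "c x s = L x"
      using lim[of x] by (auto simp: eventually_sequentially)
    ultimately show ?thesis by (intro exI[of _ "prod_encode (x, s)"]) simp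
  qed
  then have w: "m < c (\<pi>1 (w m)) (\<pi>2 (w m))" for m
    unfolding w_def by (rule LeastI_ex)
  have rec_w: "recursive w"
    unfolding w_def[abs_def]
    by (intro recursive_Least ex recursive_intros recursive_subst[OF c'])
  \<comment> \<open>Adding \<open>s\<close> to the stage at which \<open>w k\<close> was found keeps the value above \<open>k\<close> for every \<open>s\<close>.\<close>
  define B where "B m s = (MAX k\<in>{..m}. c (\<pi>1 (w k)) (\<pi>2 (w k) + s))" for m s
  define L' where "L' m = (MAX k\<in>{..m}. L (\<pi>1 (w k)))" for m
  have B_mono: "B m s \<le> B n t" if "m \<le> n" "s \<le> t" for m n s t
    unfolding B_def
  proof (intro Max.boundedI; clarsimp)
    fix k assume "k \<le> m"
    have "c (\<pi>1 (w k)) (\<pi>2 (w k) + s) \<le> c (\<pi>1 (w k)) (\<pi>2 (w k) + t)"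
      using that by (intro mono') simp
    also have "\<dots> \<le> (MAX k\<in>{..n}. c (\<pi>1 (w k)) (\<pi>2 (w k) + t))"
      using that \<open>k \<le> m\<close> by (intro Max_ge) auto
    finally show "c (\<pi>1 (w k)) (\<pi>2 (w k) + s) \<le> (MAX k\<in>{..n}. c (\<pi>1 (w k)) (\<pi>2 (w k) + t))" .
  qed
  have B_gt: "m < B m s" for m s
  proof -
    have "m < c (\<pi>1 (w m)) (\<pi>2 (w m))" by (rule w)
    also have "\<dots> \<le> c (\<pi>1 (w m)) (\<pi>2 (w m) + s)" by (rule mono') simp
    also have "\<dots> \<le> B m s" unfolding B_def by (intro Max_ge) auto
    finally show ?thesis .
  qed
  have B_lim: "\<forall>\<^sub>F s in sequentially. B m s = L' m" for m
  proof -
    have "\<forall>\<^sub>F s in sequentially. c (\<pi>1 (w k)) (\<pi>2 (w k) + s) = L (\<pi>1 (w k))" for k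
      using lim[of "\<pi>1 (w k)"]
      by (subst add.commute) (rule sequentially_offset)
    then have "\<forall>\<^sub>F s in sequentially. \<forall>k\<in>{..m}. c (\<pi>1 (w k)) (\<pi>2 (w k) + s) = L (\<pi>1 (w k))"
      by (intro eventually_ball_finite) auto
    then show ?thesis
    proof eventually_elim
      case (elim s)
      then have "(\<lambda>k. c (\<pi>1 (w k)) (\<pi>2 (w k) + s)) ` {..m} = (\<lambda>k. L (\<pi>1 (w k))) ` {..m}"
        by (intro image_cong) auto
      then show ?case by (simp only: B_def L'_def)
    qed
  qed
  have L'_gt: "m < L' m" for m
  proof -
    obtain s where "B m s = L' m"
      using B_lim[of m] by (auto simp: eventually_sequentially)
    with B_gt[of m s] show ?thesis by simp
  qed
  have L'_range: "L' m \<in> range L" for m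
  proof -
    have "L' m \<in> (\<lambda>k. L (\<pi>1 (w k))) ` {..m}"
      unfolding L'_def by (intro Max_in) auto
    then show ?thesis by blast
  qed
  define f where "f i s = rec_nat (c 0 s) (\<lambda>_ v. B v s) i" for i s
  define M where "M = rec_nat (L 0) (\<lambda>_ v. L' v)"
  have f_lim: "\<forall>\<^sub>F s in sequentially. f i s = M i" for i
  proof (induction i)
    case 0
    show ?case using lim[of 0] by (simp add: f_def M_def)
  next
    case (Suc i)
    from Suc.IH B_lim[of "M i"] show ?case
      by eventually_elim (simp add: f_def M_def)
  qed
  then have lim_f: "f i \<longlonglongrightarrow> M i" for i
    by (simp add: tendsto_nat_iff)
  then have [simp]: "lim (f i) = M i" for i
    by (rule limI)
  have "recursive2 f"
    unfolding f_def[abs_def] B_def recursive2_iff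
    by (intro recursive_intros recursive_subst[OF c'] recursive_app[OF rec_w])
  moreover have "s1_function f"
    unfolding s1_function_def
  proof (intro conjI allI)
    fix i s
    show "f i s \<le> f i (Suc s)"
      by (induction i) (simp_all add: f_def mono B_mono)
    show "convergent (f i)"
      using lim_f by (rule convergentI)
    show "lim (f i) < lim (f (Suc i))"
      by (simp add: M_def L'_gt)
  qed
  moreover have "M i \<in> range L" for i
    by (cases i) (simp_all add: M_def L'_range)
  then have "\<forall>i. lim (f i) \<in> range L" by simp
  ultimately show ?thesis by (rule that)
qed

section \<open>From c.e. substructures to class sizes\<close>

lemma eventually_card_initial:
  assumes "finite T"
  shows "\<forall>\<^sub>F s in sequentially. card {t. t < s \<and> t \<in> T} = card T"
proof -
  have "{t. t < s \<and> t \<in> T} = T" if "Suc (Max T) \<le> s" for s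
    using Max_ge[OF assms] that by fastforce
  then show ?thesis unfolding eventually_sequentially by metis
qed

text \<open>If an infinite faithful part had classes of bounded size, it would be covered by finitely many finite
classes; so its class sizes are unbounded. They are approximated from below by counting the pairs with
first component \<open>x\<close> among the first \<open>s\<close> enumerated pairs, each pair being counted only at its
first occurrence.\<close>

lemma s1_condition_if_ce_substructure:
  assumes E: "equiv UNIV E" and sub: "has_inf_faithful_substructure_with ce_rel E"
    and fin: "\<And>C. C \<in> UNIV // E \<Longrightarrow> finite C" "\<And>k. finite (classes_of_size UNIV E k)"
  shows "computable_s1_condition (eq_character UNIV E)"
proof -
  obtain A R where A: "infinite A" "faithful E A" "is_copy A (E \<inter> A \<times> A) R" "ce_rel R"
    using sub unfolding has_inf_faithful_substructure_with_def has_copy_with_def by blast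
  have R: "equiv UNIV R" using A(3) by (simp add: is_copy_def)
  obtain h where h: "bij_betw h A UNIV"
    "\<And>x y. x \<in> A \<Longrightarrow> y \<in> A \<Longrightarrow> (x, y) \<in> E \<longleftrightarrow> (h x, h y) \<in> R"
    using A(3) unfolding is_copy_def by blast
  have "R \<noteq> {}" using R by (auto simp: equiv_def refl_on_def)
  then obtain g where g: "recursive g" "R = range (\<lambda>n. prod_decode (g n))"
    using A(4) by (auto simp: ce_rel_iff)
  have sub_A: "E `` {x} \<subseteq> A" if "x \<in> A" for x
    using A(2) that unfolding faithful_def by blast
  have class_image: "R `` {h x} = h ` (E `` {x})" if "x \<in> A" for x
  proof (intro equalityI subsetI)
    fix y assume y: "y \<in> R `` {h x}"
    obtain z where z: "z \<in> A" "y = h z" using h(1) by (auto simp: bij_betw_def)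
    then show "y \<in> h ` (E `` {x})" using y h(2)[OF that z(1)] by auto
  next
    fix y assume "y \<in> h ` (E `` {x})"
    then obtain z where "(x, z) \<in> E" "y = h z" by blast
    moreover have "z \<in> A" using sub_A[OF that] \<open>(x, z) \<in> E\<close> by blast
    ultimately show "y \<in> R `` {h x}" using h(2)[OF that] by simp
  qed
  have finE: "finite (E `` {x})" for x
    using fin(1) by (simp add: quotientI)
  define L where "L y = card (R `` {y})" for y
  have L_h: "L (h x) = card (E `` {x})" if "x \<in> A" for x
    unfolding L_def class_image[OF that]
    using h(1) sub_A[OF that] by (intro card_image) (auto simp: bij_betw_def intro: inj_on_subset)
  have preimage: "\<exists>x\<in>A. y = h x" for y
    using h(1) by (auto simp: bij_betw_def)
  have finR: "finite (R `` {y})" for y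
    using preimage[of y] class_image finE by fastforce
  define c where "c x s = card {t. t < s \<and> (\<pi>1 (g t) = x \<and> (\<forall>r<t. g r \<noteq> g t))}" for x s
  have "recursive2 c"
    unfolding c_def[abs_def] recursive2_iff
    by (intro recursive_intros recursive_app[OF g(1)])
  moreover have "c x s \<le> c x (Suc s)" for x s
    unfolding c_def by (intro card_mono) auto
  moreover have "\<forall>\<^sub>F s in sequentially. c x s = L x" for x
  proof -
    define T where "T = {t. \<pi>1 (g t) = x \<and> (\<forall>r<t. g r \<noteq> g t)}"
    have "bij_betw (\<lambda>t. \<pi>2 (g t)) T (R `` {x})"
    proof (rule bij_betw_imageI)
      show "inj_on (\<lambda>t. \<pi>2 (g t)) T"
      proof (rule inj_onI)
        fix t u assume *: "t \<in> T" "u \<in> T" "\<pi>2 (g t) = \<pi>2 (g u)"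
        then have "prod_decode (g t) = prod_decode (g u)"
          by (simp add: T_def prod_eq_iff)
        then have "g t = g u" by simp
        then have "\<not> t < u" "\<not> u < t" using *(1,2) by (auto simp: T_def)
        then show "t = u" by simp
      qed
      show "(\<lambda>t. \<pi>2 (g t)) ` T = R `` {x}"
      proof (intro equalityI subsetI)
        fix y assume "y \<in> (\<lambda>t. \<pi>2 (g t)) ` T"
        then obtain t where "prod_decode (g t) = (x, y)" by (auto simp: T_def prod_eq_iff)
        then show "y \<in> R `` {x}" using g(2) by (metis Image_singleton_iff rangeI)
      next
        fix y assume "y \<in> R `` {x}"
        then have "\<exists>t. prod_decode (g t) = (x, y)" using g(2) by auto
        define t where "t = (LEAST t. prod_decode (g t) = (x, y))"
        have t: "prod_decode (g t) = (x, y)"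
          unfolding t_def by (rule LeastI_ex) fact
        have "prod_decode (g r) \<noteq> (x, y)" if "r < t" for r
          using that unfolding t_def by (rule not_less_Least)
        then have "g r \<noteq> g t" if "r < t" for r using that t by metis
        then have "t \<in> T" using t by (simp add: T_def)
        with t show "y \<in> (\<lambda>t. \<pi>2 (g t)) ` T" by (intro image_eqI[of _ _ t]) auto
      qed
    qed
    then have "finite T" "card T = L x"
      using finR bij_betw_finite bij_betw_same_card by (auto simp: L_def)
    then show ?thesis
      using eventually_card_initial[of T] by (simp add: c_def T_def)
  qed
  moreover have "\<exists>y. m < L y" for m
  proof (rule ccontr)
    assume "\<nexists>y. m < L y"
    then have le: "card (E `` {x}) \<le> m" if "x \<in> A" for x
      using L_h[OF that] by (metis not_less)
    have "A \<subseteq> \<Union> (\<Union>k\<in>{..m}. classes_of_size UNIV E k)"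
    proof
      fix x assume x: "x \<in> A"
      have "E `` {x} \<in> classes_of_size UNIV E (card (E `` {x}))"
        using finE by (simp add: classes_of_size_def quotientI)
      moreover have "x \<in> E `` {x}" using E by (rule equiv_class_self) simp
      ultimately show "x \<in> \<Union> (\<Union>k\<in>{..m}. classes_of_size UNIV E k)"
        using le[OF x] by blast
    qed
    moreover have "finite (\<Union> (\<Union>k\<in>{..m}. classes_of_size UNIV E k))"
      using fin(2) by (intro finite_Union) (auto simp: classes_of_size_def)
    ultimately show False using A(1) finite_subset by blast
  qed
  ultimately obtain f where f: "recursive2 f" "s1_function f" "\<forall>i. lim (f i) \<in> range L"
    by (rule s1_function_from_approximation)
  have "(L y, 1) \<in> eq_character UNIV E" for y
  proof -
    obtain x where x: "x \<in> A" "y = h x" using preimage by blast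
    have "x \<in> E `` {x}" using E by (rule equiv_class_self) simp
    then have "0 < card (E `` {x})" using finE by (auto simp: card_gt_0_iff)
    moreover have "{E `` {x}} \<subseteq> classes_of_size UNIV E (card (E `` {x}))"
      using finE by (simp add: classes_of_size_def quotientI)
    ultimately show ?thesis
      unfolding eq_character_def x(2) L_h[OF x(1)]
      by (auto intro!: exI[of _ "{E `` {x}}"])
  qed
  then have "(lim (f i), 1) \<in> eq_character UNIV E" for i
    using f(3) by (metis imageE)
  with f(1,2) show ?thesis by (rule computable_s1_conditionI)
qed

section \<open>From class sizes to computable substructures\<close>

text \<open>The elements of the class \<open>C i\<close> are named by the tokens in \<open>N\<close> with first component \<open>i\<close>.
Equivalence of tokens is decidable, and numbering the tokens in increasing order turns them into a
computable structure on the natural numbers.\<close>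

lemma computable_substructure_if_tokens:
  fixes C :: "nat \<Rightarrow> nat set"
  assumes E: "equiv UNIV E" and N: "infinite N" "decidable (\<lambda>z. z \<in> N)"
    and I: "\<And>z. z \<in> N \<Longrightarrow> \<pi>1 z \<in> I"
    and C: "\<And>i. i \<in> I \<Longrightarrow> C i \<in> UNIV // E" "inj_on C I"
    and k: "\<And>i. i \<in> I \<Longrightarrow> \<exists>k. bij_betw k (C i) {z \<in> N. \<pi>1 z = i}"
  shows "has_inf_faithful_substructure_with computable_rel E"
proof -
  have related: "(x, y) \<in> E \<longleftrightarrow> y \<in> C i" if "i \<in> I" "x \<in> C i" for i x y
  proof -
    have "C i = E `` {x}"
      using E C(1)[OF that(1)] that(2) by (metis equiv_class_eq_iff Image_singleton_iff UNIV_I quotientE)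
    then show ?thesis by blast
  qed
  have disjoint: "i = j" if "i \<in> I" "j \<in> I" "x \<in> C i" "x \<in> C j" for i j x
  proof -
    have "C i = C j" using quotient_disj[OF E C(1) C(1)] that by blast
    then show ?thesis using C(2) that by (auto dest: inj_onD)
  qed
  obtain k' where k': "\<And>i. i \<in> I \<Longrightarrow> bij_betw (k' i) (C i) {z \<in> N. \<pi>1 z = i}"
    using k by metis
  define idx where "idx x = (THE i. i \<in> I \<and> x \<in> C i)" for x
  have idx: "idx x = i" if "i \<in> I" "x \<in> C i" for i x
    unfolding idx_def using that disjoint by blast
  define A where "A = (\<Union>i\<in>I. C i)"
  define K where "K x = k' (idx x) x" for x
  have K: "K x \<in> N" "\<pi>1 (K x) = i" if "i \<in> I" "x \<in> C i" for i x
    using k'[OF that(1)] that by (auto simp: K_def idx bij_betw_def)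
  have bij: "bij_betw K A N"
  proof (rule bij_betw_imageI)
    show "inj_on K A"
    proof (rule inj_onI)
      fix x y assume "x \<in> A" "y \<in> A" "K x = K y"
      then obtain i j where ij: "i \<in> I" "x \<in> C i" "j \<in> I" "y \<in> C j" by (auto simp: A_def)
      then have "i = j" using K(2) \<open>K x = K y\<close> by metis
      then show "x = y"
        using k'[OF ij(1)] ij \<open>K x = K y\<close> by (auto simp: K_def idx bij_betw_def inj_on_def)
    qed
    show "K ` A = N"
    proof (intro equalityI subsetI)
      fix z assume z: "z \<in> N"
      have "z \<in> k' (\<pi>1 z) ` C (\<pi>1 z)"
        using k'[OF I[OF z]] z by (auto simp: bij_betw_def)
      then obtain x where "x \<in> C (\<pi>1 z)" "z = k' (\<pi>1 z) x" by blast
      then have "z = K x" "x \<in> A"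
        using I[OF z] idx by (auto simp: K_def A_def)
      then show "z \<in> K ` A" by blast
    qed (auto simp: A_def K)
  qed
  define S where "S = {(z, z'). \<pi>1 z = \<pi>1 z'}"
  define e where "e = enumerate N"
  have "infinite A" using bij N(1) bij_betw_finite by blast
  moreover have "faithful E A"
  proof -
    have "sym E" using E by (simp add: equiv_def)
    then show ?thesis
      unfolding faithful_def A_def using related by (blast dest: symD)
  qed
  moreover have "is_copy A (E \<inter> A \<times> A) {(i, j). (e i, e j) \<in> S}"
  proof (rule is_copy_pullback[OF _ subset_UNIV _ bij])
    show "equiv UNIV S"
      unfolding S_def equiv_def refl_on_def sym_def trans_def by auto
    show "bij_betw e UNIV N" unfolding e_def by (rule bij_enumerate[OF N(1)])
    fix x y assume "x \<in> A" "y \<in> A"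
    then obtain i j where ij: "i \<in> I" "x \<in> C i" "j \<in> I" "y \<in> C j" by (auto simp: A_def)
    then have "(x, y) \<in> E \<longleftrightarrow> i = j" using related disjoint by metis
    then show "(x, y) \<in> E \<inter> A \<times> A \<longleftrightarrow> (K x, K y) \<in> S"
      using \<open>x \<in> A\<close> \<open>y \<in> A\<close> ij K(2) by (simp add: S_def)
  qed
  moreover have "computable_rel {(i, j). (e i, e j) \<in> S}"
  proof -
    have "decidable (\<lambda>z. \<pi>1 (e (\<pi>1 z)) = \<pi>1 (e (\<pi>2 z)))"
      unfolding e_def
      by (intro recursive_intros recursive_app[OF recursive_enumerate[OF N]])
    then show ?thesis by (simp add: computable_rel_iff S_def case_prod_unfold)
  qed
  ultimately show ?thesis
    unfolding has_inf_faithful_substructure_with_def has_copy_with_def by blast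
qed

text \<open>A single class is named by all codes with first component \<open>0\<close>.\<close>

lemma computable_substructure_if_infinite_class:
  assumes "equiv UNIV E" "C \<in> UNIV // E" "infinite C"
  shows "has_inf_faithful_substructure_with computable_rel E"
proof (rule computable_substructure_if_tokens[OF assms(1)])
  let ?N = "{z. \<pi>1 z = 0}"
  have "inj (\<lambda>n. prod_encode (0, n))" by (auto simp: inj_def)
  then have "infinite (range (\<lambda>n. prod_encode (0, n)))" by (rule range_inj_infinite)
  moreover have "range (\<lambda>n. prod_encode (0, n)) \<subseteq> ?N" by auto
  ultimately show inf: "infinite ?N" using finite_subset by blast
  show "decidable (\<lambda>z. z \<in> ?N)"
    unfolding mem_Collect_eq by (intro recursive_intros)
  have "bij_betw (enumerate ?N \<circ> inv_into UNIV (enumerate C)) C ?N"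
    by (intro bij_betw_trans[OF bij_betw_inv_into[OF bij_enumerate] bij_enumerate] assms(3) inf)
  moreover have "{z \<in> ?N. \<pi>1 z = 0} = ?N" by blast
  ultimately show "\<exists>k. bij_betw k C {z \<in> ?N. \<pi>1 z = i}" if "i \<in> {0}" for i
    using that by auto
qed (use assms(2) in auto)

text \<open>The \<open>i\<close>-th of infinitely many classes of size \<open>k\<close> is named by the pairs \<open>(i, j)\<close> with
\<open>j < k\<close>.\<close>

lemma computable_substructure_if_infinitely_many_of_size:
  assumes "equiv UNIV E" "infinite (classes_of_size UNIV E k)"
  shows "has_inf_faithful_substructure_with computable_rel E"
proof -
  obtain C :: "nat \<Rightarrow> nat set" where C: "inj C" "range C \<subseteq> classes_of_size UNIV E k"
    using infinite_countable_subset[OF assms(2)] by blast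
  then have Ci: "C i \<in> UNIV // E" "finite (C i)" "card (C i) = k" for i
    by (auto simp: classes_of_size_def)
  let ?N = "{z. \<pi>2 z < k}"
  have bij: "bij_betw (\<lambda>j. prod_encode (i, j)) {..<k} {z \<in> ?N. \<pi>1 z = i}" for i
  proof (rule bij_betw_imageI)
    show "inj_on (\<lambda>j. prod_encode (i, j)) {..<k}" by (auto simp: inj_on_def)
    show "(\<lambda>j. prod_encode (i, j)) ` {..<k} = {z \<in> ?N. \<pi>1 z = i}"
      by (auto intro!: image_eqI[where x = "\<pi>2 _"])
  qed
  show ?thesis
  proof (rule computable_substructure_if_tokens[OF assms(1), where I = UNIV])
    have "C 0 \<noteq> {}" using assms(1) Ci(1) by (metis in_quotient_imp_non_empty)
    then have "0 < k" using Ci(2,3)[of 0] by (auto simp: card_gt_0_iff)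
    then have "range (\<lambda>i. prod_encode (i, 0)) \<subseteq> ?N" by auto
    moreover have "infinite (range (\<lambda>i. prod_encode (i, 0)))"
      by (rule range_inj_infinite) (auto simp: inj_def)
    ultimately show "infinite ?N" using finite_subset by blast
    show "decidable (\<lambda>z. z \<in> ?N)"
      unfolding mem_Collect_eq by (intro recursive_intros)
    show "\<exists>k. bij_betw k (C i) {z \<in> ?N. \<pi>1 z = i}" for i
      using bij_betw_same_card[OF bij] bij_betw_finite[OF bij] Ci(2,3)
      by (intro finite_same_card_bij) auto
  qed (use C(1) Ci(1) in auto)
qed

text \<open>A number \<open>j\<close> is below \<open>lim (f i)\<close> iff \<open>j < f i s\<close> for some stage \<open>s\<close>, and the first
such stage is determined by \<open>j\<close>. So for each \<open>i\<close> there are \<open>lim (f i)\<close> tokens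
\<open>(i, j, s)\<close> in which \<open>s\<close> is the first stage with \<open>j < f i s\<close>, and a bounded check
recognises them.\<close>

lemma computable_substructure_if_s1:
  assumes "equiv UNIV E" "computable_s1_condition (eq_character UNIV E)"
  shows "has_inf_faithful_substructure_with computable_rel E"
proof -
  obtain f where f: "recursive2 f" "s1_function f" "\<And>i. (lim (f i), 1) \<in> eq_character UNIV E"
    using assms(2) unfolding computable_s1_condition_def possesses_s1_def recursive2_def by blast
  have pos: "0 < lim (f i)" for i
    using f(3)[of i] by (simp add: eq_character_def)
  have "\<exists>C. C \<in> classes_of_size UNIV E (lim (f i))" for i
    using f(3)[of i] unfolding eq_character_def by (fastforce simp: card_1_singleton_iff)
  then obtain C where C: "\<And>i. C i \<in> classes_of_size UNIV E (lim (f i))" by metis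
  then have Ci: "C i \<in> UNIV // E" "finite (C i)" "card (C i) = lim (f i)" for i
    by (auto simp: classes_of_size_def)
  define N where "N = {z. \<pi>1 (\<pi>2 z) < f (\<pi>1 z) (\<pi>2 (\<pi>2 z))
    \<and> (\<forall>t<\<pi>2 (\<pi>2 z). f (\<pi>1 z) t \<le> \<pi>1 (\<pi>2 z))}"
  have bij: "bij_betw (\<lambda>j. prod_encode (i, prod_encode (j, LEAST s. j < f i s)))
    {..<lim (f i)} {z \<in> N. \<pi>1 z = i}" for i
  proof (rule bij_betw_imageI)
    show "inj_on (\<lambda>j. prod_encode (i, prod_encode (j, LEAST s. j < f i s))) {..<lim (f i)}"
      by (auto simp: inj_on_def)
    show "(\<lambda>j. prod_encode (i, prod_encode (j, LEAST s. j < f i s))) ` {..<lim (f i)}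
      = {z \<in> N. \<pi>1 z = i}"
    proof (intro equalityI subsetI)
      fix z assume "z \<in> (\<lambda>j. prod_encode (i, prod_encode (j, LEAST s. j < f i s))) ` {..<lim (f i)}"
      then obtain j where j: "j < lim (f i)"
        and z: "z = prod_encode (i, prod_encode (j, LEAST s. j < f i s))" by blast
      obtain t where "f i t = lim (f i)"
        using s1_function_eventually[OF f(2), of i] by (auto simp: eventually_sequentially)
      then have "\<exists>s. j < f i s" using j by metis
      then have "j < f i (LEAST s. j < f i s)" by (rule LeastI_ex)
      moreover have "f i t \<le> j" if "t < (LEAST s. j < f i s)" for t
        using not_less_Least[OF that] by simp
      ultimately show "z \<in> {z \<in> N. \<pi>1 z = i}" by (simp add: N_def z)
    next
      fix z assume z: "z \<in> {z \<in> N. \<pi>1 z = i}"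
      define j s where "j = \<pi>1 (\<pi>2 z)" and "s = \<pi>2 (\<pi>2 z)"
      have zjs: "z = prod_encode (i, prod_encode (j, s))"
        using z by (auto simp: j_def s_def)
      have js: "j < f i s" "\<And>t. t < s \<Longrightarrow> f i t \<le> j"
        using z by (auto simp: N_def j_def s_def)
      have "(LEAST s. j < f i s) = s"
      proof (rule Least_equality)
        show "j < f i s" by (rule js(1))
        fix r assume "j < f i r"
        then show "s \<le> r" using js(2)[of r] by linarith
      qed
      moreover have "j < lim (f i)"
        using js(1) s1_function_le_lim[OF f(2), of i s] by simp
      ultimately show "z \<in> (\<lambda>j. prod_encode (i, prod_encode (j, LEAST s. j < f i s))) ` {..<lim (f i)}"
        using zjs by auto
    qed
  qed
  show ?thesis
  proof (rule computable_substructure_if_tokens[OF assms(1), where I = UNIV])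
    have "i \<in> \<pi>1 ` N" for i
    proof -
      have "{z \<in> N. \<pi>1 z = i} \<noteq> {}" using bij[of i] pos[of i] by (auto simp: bij_betw_def)
      then show ?thesis by blast
    qed
    then have "\<pi>1 ` N = UNIV" by blast
    then show "infinite N" using infinite_UNIV_nat finite_imageI by metis
    show "decidable (\<lambda>z. z \<in> N)"
      unfolding N_def mem_Collect_eq
      by (intro recursive_intros recursive_subst[OF f(1)[unfolded recursive2_iff]])
    show "inj C"
    proof (rule injI)
      fix i j assume "C i = C j"
      then have "lim (f i) = lim (f j)" using Ci(3) by metis
      then show "i = j" by (rule injD[OF s1_function_inj_lim[OF f(2)]])
    qed
    show "\<exists>k. bij_betw k (C i) {z \<in> N. \<pi>1 z = i}" for i
      using bij_betw_same_card[OF bij[of i]] bij_betw_finite[OF bij[of i]] Ci(2,3)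
      by (intro finite_same_card_bij) auto
  qed (use Ci(1) in auto)
qed

section \<open>The equivalences\<close>

lemma has_copy_with_mono:
  assumes "has_copy_with P A R" "\<And>R'. equiv UNIV R' \<Longrightarrow> P R' \<Longrightarrow> Q R'"
  shows "has_copy_with Q A R"
proof -
  obtain R' where "is_copy A R R'" "P R'" using assms(1) unfolding has_copy_with_def by blast
  moreover from this have "Q R'" using assms(2) by (simp add: is_copy_def)
  ultimately show ?thesis unfolding has_copy_with_def by blast
qed

theorem theorem2p6:
  fixes E :: "nat rel"
  assumes "equiv UNIV E"
  shows
    "let a = has_copy_with faithfully_strongly_generically_computable UNIV E;
         b = has_copy_with faithfully_generically_computable UNIV E;
         c = has_copy_with faithfully_generically_ce UNIV E;
         d = has_inf_faithful_substructure_with computable_rel E;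
         e = has_inf_faithful_substructure_with ce_rel E;
         f = ((\<exists>C \<in> UNIV // E. infinite C) \<or>
              (\<exists>k. infinite (classes_of_size UNIV E k)) \<or>
              computable_s1_condition (eq_character UNIV E))
     in (a \<longleftrightarrow> b) \<and> (b \<longleftrightarrow> c) \<and> (c \<longleftrightarrow> d) \<and> (d \<longleftrightarrow> e) \<and> (e \<longleftrightarrow> f)"
proof -
  define a where "a = has_copy_with faithfully_strongly_generically_computable UNIV E"
  define b where "b = has_copy_with faithfully_generically_computable UNIV E"
  define c where "c = has_copy_with faithfully_generically_ce UNIV E"
  define d where "d = has_inf_faithful_substructure_with computable_rel E"
  define e where "e = has_inf_faithful_substructure_with ce_rel E"
  define f where "f = ((\<exists>C \<in> UNIV // E. infinite C) \<or>
    (\<exists>k. infinite (classes_of_size UNIV E k)) \<or> computable_s1_condition (eq_character UNIV E))"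
  have "a \<longrightarrow> b"
    unfolding a_def b_def by (blast intro: has_copy_with_mono faithfully_generically_computable_if_strongly)
  moreover have "b \<longrightarrow> c"
    unfolding b_def c_def by (blast intro: has_copy_with_mono faithfully_generically_ce_if_computable)
  moreover have "c \<longrightarrow> e"
    unfolding c_def e_def using ce_substructure_if_generically_ce_copy by blast
  moreover have "e \<longrightarrow> f"
    unfolding e_def f_def using s1_condition_if_ce_substructure[OF assms] by blast
  moreover have "f \<longrightarrow> d"
    unfolding f_def d_def
    using computable_substructure_if_infinite_class[OF assms]
      computable_substructure_if_infinitely_many_of_size[OF assms]
      computable_substructure_if_s1[OF assms] by blast
  moreover have "d \<longrightarrow> a"
    unfolding d_def a_def using strongly_generic_copy_if_computable_substructure[OF assms] by blast
  ultimately have "(a \<longleftrightarrow> b) \<and> (b \<longleftrightarrow> c) \<and> (c \<longleftrightarrow> d) \<and> (d \<longleftrightarrow> e) \<and> (e \<longleftrightarrow> f)"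
    by blast
  then show ?thesis
    unfolding Let_def a_def b_def c_def d_def e_def f_def .
qed

end
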